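(* Let $M$ be a linear algebraic monoid with zero element $0$ and assume that for some (non-trivial) polynomial character $\lambda:M\to\Bbbk$ the unit group satisfies $G=G(M)=M_\lambda=\{m\in M:\lambda(m)\neq0\}$. Assume moreover that $M$ admits a proper $\Omega$-process with respect to $\lambda$. If $V$ is a finite dimensional rational $G$-module, then the ring of invariants $\operatorname{S}(V)^G$ is finitely generated (as a $\Bbbk$-algebra).
   Context: $\Bbbk$ is an algebraically closed field of characteristic zero. A linear algebraic monoid $M$ is an irreducible affine normal algebraic variety over $\Bbbk$ with an associative product $M\times M\to M$ that is a morphism of varieties and has a neutral element $1$. Its unit group $G(M)$ is the group of invertible elements, an affine algebraic group open in $M$. A zero element is $0\in M$ with $0m=m0=0$ for all $m$. $\operatorname{S}(V)$ is the symmetric algebra of $V$, with the induced action of $G$ by algebra automorphisms. A polynomial character of $M$ is a multiplicative morphism $\lambda:M\to\Bbbk$ with $\lambda(1)=1$; it is trivial if it takes only the value $1$. For $f\in\Bbbk[M]$, $m\in M$, put $(m\cdot f)(x)=f(xm)$ and $(f\cdot m)(x)=f(mx)$. An $\Omega$-process with respect (associated) to a non-trivial $\lambda$ is a non-zero linear operator $\Omega:\Bbbk[M]\to\Bbbk[M]$ such that $\Omega(f\cdot m)=\lambda(m)\,\Omega(f)\cdot m$ and $\Omega(m\cdot f)=\lambda(m)\,m\cdot\Omega(f)$ for all $f\in\Bbbk[M]$, $m\in M$. It is proper if $\alpha_s:=\Omega(\lambda^s)(1)\neq0$ for all $s=1,2,\dots$. *)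

theory Defs
  imports
    "HOL-Library.Poly_Mapping"
    "HOL-Library.FuncSet"
    "HOL-Computational_Algebra.Polynomial"
    "HOL-Algebra.QuotRing"
    "HOL-Algebra.Generated_Rings"
begin

section \<open>Polynomials in several variables\<close>

text \<open>Monomials are exponent vectors \<^typ>\<open>'x \<Rightarrow>\<^sub>0 nat\<close>; the set of variables
  is the whole type \<^typ>\<open>'x\<close>, which may be infinite.\<close>

type_synonym ('x, 'k) mpoly = "('x \<Rightarrow>\<^sub>0 nat) \<Rightarrow>\<^sub>0 'k"

definition Const :: "'k::zero \<Rightarrow> ('x, 'k) mpoly"
  where "Const c = Poly_Mapping.single 0 c"

definition Var :: "'x \<Rightarrow> ('x, 'k::zero_neq_one) mpoly"
  where "Var v = Poly_Mapping.single (Poly_Mapping.single v 1) 1"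

text \<open>\<open>mp_eval h \<sigma> p\<close> substitutes \<open>\<sigma> v\<close> for the variable \<open>v\<close>, the
  coefficients being mapped by \<open>h\<close> to the target ring.\<close>

definition mp_eval ::
    "('k::zero \<Rightarrow> 'r::comm_semiring_1) \<Rightarrow> ('x \<Rightarrow> 'r) \<Rightarrow> ('x, 'k) mpoly \<Rightarrow> 'r"
  where "mp_eval h \<sigma> p =
    (\<Sum>m \<in> Poly_Mapping.keys p. h (Poly_Mapping.lookup p m) *
       (\<Prod>v \<in> Poly_Mapping.keys m. \<sigma> v ^ Poly_Mapping.lookup m v))"

abbreviation peval :: "('x, 'k::comm_semiring_1) mpoly \<Rightarrow> ('x \<Rightarrow> 'k) \<Rightarrow> 'k"
  where "peval p x \<equiv> mp_eval (\<lambda>c. c) x p"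

lemma mp_eval_superset:
  assumes "h 0 = 0" "finite A" "Poly_Mapping.keys p \<subseteq> A"
  shows "mp_eval h \<sigma> p = (\<Sum>m\<in>A. h (Poly_Mapping.lookup p m) *
    (\<Prod>v \<in> Poly_Mapping.keys m. \<sigma> v ^ Poly_Mapping.lookup m v))"
  unfolding mp_eval_def using assms
  by (intro sum.mono_neutral_left) (auto simp: in_keys_iff)

lemma mp_eval_single:
  assumes "h 0 = 0"
  shows "mp_eval h \<sigma> (Poly_Mapping.single m c) =
    h c * (\<Prod>v \<in> Poly_Mapping.keys m. \<sigma> v ^ Poly_Mapping.lookup m v)"
  using mp_eval_superset[of h "{m}" "Poly_Mapping.single m c" \<sigma>] assms by auto

lemma mp_eval_Const: "h 0 = 0 \<Longrightarrow> mp_eval h \<sigma> (Const c) = h c"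
  by (simp add: Const_def mp_eval_single)

lemma mp_eval_Var: "h 0 = 0 \<Longrightarrow> h 1 = 1 \<Longrightarrow> mp_eval h \<sigma> (Var v) = \<sigma> v"
  by (simp add: Var_def mp_eval_single)

lemma mp_eval_add:
  assumes "h 0 = 0" "\<And>a b. h (a + b) = h a + h b"
  shows "mp_eval h \<sigma> (p + q) = mp_eval h \<sigma> p + mp_eval h \<sigma> q"
proof -
  let ?A = "Poly_Mapping.keys p \<union> Poly_Mapping.keys q"
  have "Poly_Mapping.keys (p + q) \<subseteq> ?A" by (rule keys_add)
  then show ?thesis
    by (simp add: mp_eval_superset[of h ?A] assms lookup_add distrib_right sum.distrib)
qed

lemma mp_eval_0: "mp_eval h \<sigma> 0 = 0"
  by (simp add: mp_eval_def)

lemma mp_eval_sum: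
  assumes "h 0 = 0" "\<And>a b. h (a + b) = h a + h b"
  shows "mp_eval h \<sigma> (\<Sum>i\<in>I. f i) = (\<Sum>i\<in>I. mp_eval h \<sigma> (f i))"
  by (induction I rule: infinite_finite_induct) (simp_all add: mp_eval_0 mp_eval_add assms)

lemma mpoly_sum_single:
  "p = (\<Sum>m\<in>Poly_Mapping.keys p. Poly_Mapping.single m (Poly_Mapping.lookup p m))"
  by (rule poly_mapping_eqI)
    (simp add: lookup_sum lookup_single when_def in_keys_iff)

lemma monomial_eval_add:
  fixes \<sigma> :: "'x \<Rightarrow> 'r::comm_semiring_1"
  shows "(\<Prod>v \<in> Poly_Mapping.keys (m + n). \<sigma> v ^ Poly_Mapping.lookup (m + n) v) =
    (\<Prod>v \<in> Poly_Mapping.keys m. \<sigma> v ^ Poly_Mapping.lookup m v) *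
    (\<Prod>v \<in> Poly_Mapping.keys n. \<sigma> v ^ Poly_Mapping.lookup n v)"
proof -
  let ?A = "Poly_Mapping.keys m \<union> Poly_Mapping.keys n"
  have *: "(\<Prod>v \<in> Poly_Mapping.keys k. \<sigma> v ^ Poly_Mapping.lookup k v) =
      (\<Prod>v \<in> ?A. \<sigma> v ^ Poly_Mapping.lookup k v)" if "Poly_Mapping.keys k \<subseteq> ?A" for k
    using that by (intro prod.mono_neutral_left) (auto simp: in_keys_iff)
  show ?thesis
    unfolding *[OF keys_add] *[OF Un_upper1] *[OF Un_upper2]
    by (simp add: lookup_add power_add prod.distrib)
qed

lemma mp_eval_mult:
  fixes h :: "'k::comm_semiring_1 \<Rightarrow> 'r::comm_semiring_1"
  assumes "h 0 = 0" "\<And>a b. h (a + b) = h a + h b" "\<And>a b. h (a * b) = h a * h b"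
  shows "mp_eval h \<sigma> (p * q) = mp_eval h \<sigma> p * mp_eval h \<sigma> q"
proof -
  let ?s = "\<lambda>p m. Poly_Mapping.single m (Poly_Mapping.lookup p m)"
  let ?K = "Poly_Mapping.keys"
  have "mp_eval h \<sigma> (p * q) = mp_eval h \<sigma> ((\<Sum>m\<in>?K p. ?s p m) * (\<Sum>n\<in>?K q. ?s q n))"
    by (simp flip: mpoly_sum_single)
  also have "\<dots> = (\<Sum>m\<in>?K p. \<Sum>n\<in>?K q. mp_eval h \<sigma> (?s p m * ?s q n))"
    by (simp add: sum_product mp_eval_sum assms(1,2))
  also have "\<dots> = (\<Sum>m\<in>?K p. \<Sum>n\<in>?K q. mp_eval h \<sigma> (?s p m) * mp_eval h \<sigma> (?s q n))"
    by (intro sum.cong refl)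
      (simp add: mult_single mp_eval_single assms monomial_eval_add mult_ac)
  also have "\<dots> = mp_eval h \<sigma> (\<Sum>m\<in>?K p. ?s p m) * mp_eval h \<sigma> (\<Sum>n\<in>?K q. ?s q n)"
    by (simp add: sum_product mp_eval_sum assms(1,2))
  finally show ?thesis by (simp flip: mpoly_sum_single)
qed


section \<open>Affine varieties\<close>

text \<open>Affine space over \<^typ>\<open>'k\<close> is \<^typ>\<open>'n \<Rightarrow> 'k\<close> with a finite index
  type \<^typ>\<open>'n\<close>; affine varieties are closed subsets of affine spaces, and functions on a
  subset of an affine space are extensional, that is, \<^const>\<open>undefined\<close> outside it.\<close>

definition zariski_closed :: "('n::finite \<Rightarrow> 'k::field) set \<Rightarrow> bool"
  where "zariski_closed X \<longleftrightarrow> (\<exists>S. X = {x. \<forall>p\<in>S. peval p x = 0})"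

definition irreducible_closed :: "('n::finite \<Rightarrow> 'k::field) set \<Rightarrow> bool"
  where "irreducible_closed X \<longleftrightarrow> zariski_closed X \<and> X \<noteq> {} \<and>
    (\<forall>A B. zariski_closed A \<longrightarrow> zariski_closed B \<longrightarrow> X = A \<union> B \<longrightarrow> X = A \<or> X = B)"

definition coord_ring :: "('n::finite \<Rightarrow> 'k::field) set \<Rightarrow> (('n \<Rightarrow> 'k) \<Rightarrow> 'k) set"
  where "coord_ring X = {restrict (peval p) X | p. True}"

text \<open>For irreducible \<open>X\<close>, a fraction \<open>a / b\<close> of the function field is
  determined by its values on the dense open set where \<open>b\<close> does not vanish. So the
  definition says that every element of the function field that is integral over the
  coordinate ring lies in the coordinate ring.\<close>

definition normal_variety :: "('n::finite \<Rightarrow> 'k::field) set \<Rightarrow> bool"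
  where "normal_variety X \<longleftrightarrow>
    (\<forall>a\<in>coord_ring X. \<forall>b\<in>coord_ring X. (\<exists>x\<in>X. b x \<noteq> 0) \<longrightarrow>
      (\<exists>d. \<exists>c. (\<forall>i<d. c i \<in> coord_ring X) \<and>
         (\<forall>x\<in>X. b x \<noteq> 0 \<longrightarrow> (a x / b x) ^ d + (\<Sum>i<d. c i x * (a x / b x) ^ i) = 0)) \<longrightarrow>
      (\<exists>f\<in>coord_ring X. \<forall>x\<in>X. b x \<noteq> 0 \<longrightarrow> a x / b x = f x))"

definition variety_morphism ::
    "('a::finite \<Rightarrow> 'k::field) set \<Rightarrow> ('b::finite \<Rightarrow> 'k) set \<Rightarrow> (('a \<Rightarrow> 'k) \<Rightarrow> 'b \<Rightarrow> 'k) \<Rightarrow> bool"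
  where "variety_morphism X Y f \<longleftrightarrow>
    (\<forall>x\<in>X. f x \<in> Y) \<and> (\<forall>i. \<exists>p. \<forall>x\<in>X. f x i = peval p x)"

definition variety_prod ::
    "('a \<Rightarrow> 'k) set \<Rightarrow> ('b \<Rightarrow> 'k) set \<Rightarrow> ('a + 'b \<Rightarrow> 'k) set"
  where "variety_prod X Y = {z. z \<circ> Inl \<in> X \<and> z \<circ> Inr \<in> Y}"

text \<open>Regular functions on a locally closed subset \<open>U\<close> of affine space: locally
  fractions of polynomials. The set \<open>Z\<close> is the complement of the neighbourhood of
  \<open>x\<close>.\<close>

definition regular_functions :: "('n::finite \<Rightarrow> 'k::field) set \<Rightarrow> (('n \<Rightarrow> 'k) \<Rightarrow> 'k) set"
  where "regular_functions U = {f \<in> extensional U.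
    \<forall>x\<in>U. \<exists>Z p q. zariski_closed Z \<and> x \<notin> Z \<and>
      (\<forall>y\<in>U - Z. peval q y \<noteq> 0 \<and> f y = peval p y / peval q y)}"


section \<open>Linear algebraic monoids and Omega-processes\<close>

definition unit_group :: "'m set \<Rightarrow> ('m \<Rightarrow> 'm \<Rightarrow> 'm) \<Rightarrow> 'm \<Rightarrow> 'm set"
  where "unit_group M mul e = {m \<in> M. \<exists>n\<in>M. mul m n = e \<and> mul n m = e}"

locale linear_algebraic_monoid =
  fixes M :: "('n::finite \<Rightarrow> 'k::{alg_closed_field, field_char_0}) set"
    and mul :: "('n \<Rightarrow> 'k) \<Rightarrow> ('n \<Rightarrow> 'k) \<Rightarrow> ('n \<Rightarrow> 'k)"
    and e :: "'n \<Rightarrow> 'k"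
  assumes irreducible: "irreducible_closed M"
    and normal: "normal_variety M"
    and mul_morphism:
      "variety_morphism (variety_prod M M) M (\<lambda>z. mul (z \<circ> Inl) (z \<circ> Inr))"
    and mul_assoc: "\<lbrakk>x \<in> M; y \<in> M; z \<in> M\<rbrakk> \<Longrightarrow> mul (mul x y) z = mul x (mul y z)"
    and e_in: "e \<in> M"
    and e_left: "x \<in> M \<Longrightarrow> mul e x = x"
    and e_right: "x \<in> M \<Longrightarrow> mul x e = x"
begin

abbreviation G :: "('n \<Rightarrow> 'k) set"
  where "G \<equiv> unit_group M mul e"

definition zero_element :: "('n \<Rightarrow> 'k) \<Rightarrow> bool"
  where "zero_element z \<longleftrightarrow> z \<in> M \<and> (\<forall>m\<in>M. mul z m = z \<and> mul m z = z)"

definition polynomial_character :: "(('n \<Rightarrow> 'k) \<Rightarrow> 'k) \<Rightarrow> bool"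
  where "polynomial_character \<chi> \<longleftrightarrow> \<chi> \<in> coord_ring M \<and>
    (\<forall>x\<in>M. \<forall>y\<in>M. \<chi> (mul x y) = \<chi> x * \<chi> y) \<and> \<chi> e = 1"

definition nontrivial_character :: "(('n \<Rightarrow> 'k) \<Rightarrow> 'k) \<Rightarrow> bool"
  where "nontrivial_character \<chi> \<longleftrightarrow> polynomial_character \<chi> \<and> (\<exists>m\<in>M. \<chi> m \<noteq> 1)"

text \<open>The left translate \<open>m \<cdot> f\<close> and the right translate \<open>f \<cdot> m\<close>.\<close>

definition ltrans :: "('n \<Rightarrow> 'k) \<Rightarrow> (('n \<Rightarrow> 'k) \<Rightarrow> 'k) \<Rightarrow> (('n \<Rightarrow> 'k) \<Rightarrow> 'k)"
  where "ltrans m f = (\<lambda>x\<in>M. f (mul x m))"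

definition rtrans :: "(('n \<Rightarrow> 'k) \<Rightarrow> 'k) \<Rightarrow> ('n \<Rightarrow> 'k) \<Rightarrow> (('n \<Rightarrow> 'k) \<Rightarrow> 'k)"
  where "rtrans f m = (\<lambda>x\<in>M. f (mul m x))"

definition linear_operator :: "((('n \<Rightarrow> 'k) \<Rightarrow> 'k) \<Rightarrow> (('n \<Rightarrow> 'k) \<Rightarrow> 'k)) \<Rightarrow> bool"
  where "linear_operator T \<longleftrightarrow>
    (\<forall>f\<in>coord_ring M. T f \<in> coord_ring M) \<and>
    (\<forall>f\<in>coord_ring M. \<forall>g\<in>coord_ring M. T (\<lambda>x\<in>M. f x + g x) = (\<lambda>x\<in>M. T f x + T g x)) \<and>
    (\<forall>c. \<forall>f\<in>coord_ring M. T (\<lambda>x\<in>M. c * f x) = (\<lambda>x\<in>M. c * T f x))"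

definition omega_process ::
    "(('n \<Rightarrow> 'k) \<Rightarrow> 'k) \<Rightarrow> ((('n \<Rightarrow> 'k) \<Rightarrow> 'k) \<Rightarrow> (('n \<Rightarrow> 'k) \<Rightarrow> 'k)) \<Rightarrow> bool"
  where "omega_process \<chi> \<Omega> \<longleftrightarrow> nontrivial_character \<chi> \<and> linear_operator \<Omega> \<and>
    (\<exists>f\<in>coord_ring M. \<exists>x\<in>M. \<Omega> f x \<noteq> 0) \<and>
    (\<forall>f\<in>coord_ring M. \<forall>m\<in>M.
       \<Omega> (rtrans f m) = (\<lambda>x\<in>M. \<chi> m * rtrans (\<Omega> f) m x) \<and>
       \<Omega> (ltrans m f) = (\<lambda>x\<in>M. \<chi> m * ltrans m (\<Omega> f) x))"

definition proper_omega_process ::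
    "(('n \<Rightarrow> 'k) \<Rightarrow> 'k) \<Rightarrow> ((('n \<Rightarrow> 'k) \<Rightarrow> 'k) \<Rightarrow> (('n \<Rightarrow> 'k) \<Rightarrow> 'k)) \<Rightarrow> bool"
  where "proper_omega_process \<chi> \<Omega> \<longleftrightarrow> omega_process \<chi> \<Omega> \<and>
    (\<forall>s\<ge>1. \<Omega> (\<lambda>x\<in>M. \<chi> x ^ s) e \<noteq> 0)"

text \<open>Rational modules of the unit group: representations whose matrix coefficients are
  regular functions on the open subset \<open>G\<close> of \<open>M\<close>.\<close>

definition rational_module ::
    "('k \<Rightarrow> 'v::ab_group_add \<Rightarrow> 'v) \<Rightarrow> (('n \<Rightarrow> 'k) \<Rightarrow> 'v \<Rightarrow> 'v) \<Rightarrow> bool"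
  where "rational_module scale \<rho> \<longleftrightarrow>
    (\<forall>g\<in>G. Vector_Spaces.linear scale scale (\<rho> g)) \<and>
    (\<forall>v. \<rho> e v = v) \<and>
    (\<forall>g\<in>G. \<forall>h\<in>G. \<forall>v. \<rho> (mul g h) v = \<rho> g (\<rho> h v)) \<and>
    (\<forall>\<phi> v. Vector_Spaces.linear scale (*) \<phi> \<longrightarrow>
       (\<lambda>g\<in>G. \<phi> (\<rho> g v)) \<in> regular_functions G)"

end


section \<open>The symmetric algebra\<close>

text \<open>\<open>S(V)\<close> is the commutative algebra generated by the elements of \<open>V\<close>
  subject to the linear relations of \<open>V\<close>, which is the universal commutative algebra with a
  linear map from \<open>V\<close>. Its elements are cosets of polynomials with variables
  \<open>V\<close>.\<close>

definition mpoly_ring :: "('x, 'k::comm_ring_1) mpoly ring"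
  where "mpoly_ring = \<lparr>carrier = UNIV, mult = (*), one = 1, zero = 0, add = (+)\<rparr>"

definition sym_ideal :: "('k::field \<Rightarrow> 'v::ab_group_add \<Rightarrow> 'v) \<Rightarrow> ('v, 'k) mpoly set"
  where "sym_ideal scale = genideal mpoly_ring
    ({Var (v + w) - Var v - Var w | v w. True} \<union>
     {Var (scale c v) - Const c * Var v | c v. True})"

definition sym_algebra :: "('k::field \<Rightarrow> 'v::ab_group_add \<Rightarrow> 'v) \<Rightarrow> ('v, 'k) mpoly set ring"
  where "sym_algebra scale = mpoly_ring Quot sym_ideal scale"

definition sym_class ::
    "('k::field \<Rightarrow> 'v::ab_group_add \<Rightarrow> 'v) \<Rightarrow> ('v, 'k) mpoly \<Rightarrow> ('v, 'k) mpoly set"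
  where "sym_class scale p = sym_ideal scale +>\<^bsub>mpoly_ring\<^esub> p"

definition sym_scalars :: "('k::field \<Rightarrow> 'v::ab_group_add \<Rightarrow> 'v) \<Rightarrow> ('v, 'k) mpoly set set"
  where "sym_scalars scale = range (\<lambda>c. sym_class scale (Const c))"

text \<open>The algebra endomorphism of \<open>S(V)\<close> induced by a linear map \<open>T\<close>: the
  substitution of \<open>T v\<close> for \<open>v\<close> sends all elements of a coset \<open>A\<close> to one
  coset, so the union below is over equal sets (see \<open>sym_map_class\<close>).\<close>

definition sym_map ::
    "('k::field \<Rightarrow> 'v::ab_group_add \<Rightarrow> 'v) \<Rightarrow> ('v \<Rightarrow> 'v) \<Rightarrow> ('v, 'k) mpoly set \<Rightarrow> ('v, 'k) mpoly set"
  where "sym_map scale T A = (\<Union>p\<in>A. sym_class scale (mp_eval Const (\<lambda>v. Var (T v)) p))"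

lemma Const_simps:
  "Const 0 = 0" "Const 1 = 1" "Const (a + b) = Const a + Const b"
  "Const (a * b) = Const a * Const b"
  for a b :: "'k::comm_semiring_1"
  by (simp_all add: Const_def single_add mult_single)

lemma cring_mpoly_ring: "cring (mpoly_ring :: ('x, 'k::comm_ring_1) mpoly ring)"
proof (rule cringI)
  show "abelian_group (mpoly_ring :: ('x, 'k) mpoly ring)"
  proof (rule abelian_groupI)
    fix x :: "('x, 'k) mpoly"
    show "\<exists>y\<in>carrier mpoly_ring. y \<oplus>\<^bsub>mpoly_ring\<^esub> x = \<zero>\<^bsub>mpoly_ring\<^esub>"
      by (intro bexI[of _ "- x"]) (simp_all add: mpoly_ring_def)
  qed (simp_all add: mpoly_ring_def algebra_simps)
  show "Group.comm_monoid (mpoly_ring :: ('x, 'k) mpoly ring)"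
    by (rule comm_monoidI) (simp_all add: mpoly_ring_def mult_ac)
qed (simp_all add: mpoly_ring_def algebra_simps)

lemma ideal_sym_ideal: "ideal (sym_ideal scale) mpoly_ring"
proof -
  interpret cring "mpoly_ring :: ('a, 'b) mpoly ring" by (rule cring_mpoly_ring)
  show ?thesis unfolding sym_ideal_def by (rule genideal_ideal) (simp add: mpoly_ring_def)
qed

lemma cring_sym_algebra: "cring (sym_algebra scale)"
  unfolding sym_algebra_def
  by (rule ideal.quotient_is_cring[OF ideal_sym_ideal cring_mpoly_ring])

lemma mpoly_minus: "\<ominus>\<^bsub>mpoly_ring\<^esub> q = - q" for q :: "('x, 'k::comm_ring_1) mpoly"
proof -
  interpret cring "mpoly_ring :: ('x, 'k) mpoly ring" by (rule cring_mpoly_ring)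
  show ?thesis by (rule minus_equality) (simp_all add: mpoly_ring_def)
qed

lemma sym_ideal_closed:
  "0 \<in> sym_ideal scale"
  "p \<in> sym_ideal scale \<Longrightarrow> q \<in> sym_ideal scale \<Longrightarrow> p + q \<in> sym_ideal scale"
  "p \<in> sym_ideal scale \<Longrightarrow> - p \<in> sym_ideal scale"
  "p \<in> sym_ideal scale \<Longrightarrow> r * p \<in> sym_ideal scale"
proof -
  interpret ideal "sym_ideal scale" mpoly_ring by (rule ideal_sym_ideal)
  show "0 \<in> sym_ideal scale"
    using additive_subgroup.zero_closed[OF is_additive_subgroup] by (simp add: mpoly_ring_def)
  show "p \<in> sym_ideal scale \<Longrightarrow> q \<in> sym_ideal scale \<Longrightarrow> p + q \<in> sym_ideal scale"
    using additive_subgroup.a_closed[OF is_additive_subgroup, of p q] by (simp add: mpoly_ring_def)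
  show "p \<in> sym_ideal scale \<Longrightarrow> - p \<in> sym_ideal scale"
    using additive_subgroup.a_inv_closed[OF is_additive_subgroup, of p] by (simp add: mpoly_minus)
  show "p \<in> sym_ideal scale \<Longrightarrow> r * p \<in> sym_ideal scale"
    using I_l_closed[of p r] by (simp add: mpoly_ring_def)
qed

lemma in_sym_class_iff: "x \<in> sym_class scale p \<longleftrightarrow> x - p \<in> sym_ideal scale"
proof -
  have "x \<in> sym_class scale p \<longleftrightarrow> (\<exists>h\<in>sym_ideal scale. x = h + p)"
    by (auto simp: sym_class_def a_r_coset_def r_coset_def mpoly_ring_def)
  also have "\<dots> \<longleftrightarrow> x - p \<in> sym_ideal scale"
    by (metis add_diff_cancel_right' diff_add_cancel)
  finally show ?thesis .
qed

lemma sym_class_eq_iff: "sym_class scale p = sym_class scale q \<longleftrightarrow> p - q \<in> sym_ideal scale"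
proof -
  show ?thesis
  proof
    assume "sym_class scale p = sym_class scale q"
    then show "p - q \<in> sym_ideal scale" 
      using in_sym_class_iff[of p scale p] in_sym_class_iff[of p scale q] sym_ideal_closed(1)[of scale]
      by auto
  next
    assume pq: "p - q \<in> sym_ideal scale"
    show "sym_class scale p = sym_class scale q"
    proof (rule Set.set_eqI)
      fix x
      have "x - q = (x - p) + (p - q)" "x - p = (x - q) + (- (p - q))" by simp_all
      then show "x \<in> sym_class scale p \<longleftrightarrow> x \<in> sym_class scale q"
        unfolding in_sym_class_iff using pq sym_ideal_closed(2,3) by metis
    qed
  qed
qed

lemma sym_map_class:
  fixes scale :: "'a::field \<Rightarrow> 'b::ab_group_add \<Rightarrow> 'b"
  assumes T: "Vector_Spaces.linear scale scale T"
  shows "sym_map scale T (sym_class scale p) =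
    sym_class scale (mp_eval Const (\<lambda>v. Var (T v)) p)"
proof -
  let ?f = "mp_eval Const (\<lambda>v. Var (T v))"
  let ?R = "mpoly_ring :: ('b, 'a) mpoly ring"
  have add: "?f (x + y) = ?f x + ?f y" for x y :: "('b, 'a) mpoly"
    by (rule mp_eval_add) (simp_all add: Const_simps)
  have mult: "?f (x * y) = ?f x * ?f y" for x y :: "('b, 'a) mpoly"
    by (rule mp_eval_mult) (simp_all add: Const_simps)
  have var: "?f (Var v) = (Var (T v) :: ('b, 'a) mpoly)" for v
    by (rule mp_eval_Var) (simp_all add: Const_simps)
  have const: "?f (Const c) = Const c" for c :: 'a
    by (rule mp_eval_Const) (simp_all add: Const_simps)
  have minus: "?f (- x) = - ?f x" for x :: "('b, 'a) mpoly"
    using add[of x "- x"] by (simp add: mp_eval_0 eq_neg_iff_add_eq_0 add.commute)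
  have diff: "?f (x - y) = ?f x - ?f y" for x y :: "('b, 'a) mpoly"
    using add[of x "- y"] by (simp add: minus)
  interpret R: cring ?R by (rule cring_mpoly_ring)
  have gens: "Var (v + w) - Var v - Var w \<in> sym_ideal scale"
    "Var (scale c v) - Const c * Var v \<in> sym_ideal scale" for v w c
    unfolding sym_ideal_def by (rule set_mp[OF R.genideal_self], simp add: mpoly_ring_def, blast)+
  have pre: "ideal {x. ?f x \<in> sym_ideal scale} ?R"
  proof (rule idealI[OF R.ring_axioms])
    show "subgroup {x. ?f x \<in> sym_ideal scale} (add_monoid ?R)"
    proof (rule R.add.subgroupI)
      show "{x. ?f x \<in> sym_ideal scale} \<noteq> {}"
        using mp_eval_0 sym_ideal_closed(1) by (metis empty_iff mem_Collect_eq)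
      show "\<ominus>\<^bsub>?R\<^esub> a \<in> {x. ?f x \<in> sym_ideal scale}" if "a \<in> {x. ?f x \<in> sym_ideal scale}" for a
        using that by (simp add: mpoly_minus minus sym_ideal_closed)
    qed (auto simp: mpoly_ring_def add sym_ideal_closed)
    show "x \<otimes>\<^bsub>?R\<^esub> a \<in> {x. ?f x \<in> sym_ideal scale}"
      "a \<otimes>\<^bsub>?R\<^esub> x \<in> {x. ?f x \<in> sym_ideal scale}"
      if "a \<in> {x. ?f x \<in> sym_ideal scale}" "x \<in> carrier ?R" for a x
      using that sym_ideal_closed(4)[of "?f a" scale "?f x"]
      by (simp_all add: mpoly_ring_def mult mult.commute)
  qed
  interpret T: Vector_Spaces.linear scale scale T by (rule T)
  have "?f (Var (v + w) - Var v - Var w) \<in> sym_ideal scale"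
    "?f (Var (scale c v) - Const c * Var v) \<in> sym_ideal scale" for v w c
    using gens by (simp_all add: diff mult var const T.add T.scale)
  then have *: "sym_ideal scale \<subseteq> {x. ?f x \<in> sym_ideal scale}"
    by (subst sym_ideal_def, intro R.genideal_minimal pre) blast
  have "sym_class scale (?f x) = sym_class scale (?f p)" if "x \<in> sym_class scale p" for x
    using * that by (auto simp: in_sym_class_iff sym_class_eq_iff diff)
  moreover have "p \<in> sym_class scale p" by (simp add: in_sym_class_iff sym_ideal_closed)
  ultimately show ?thesis unfolding sym_map_def by blast
qed

definition sym_invariants ::
    "('k::field \<Rightarrow> 'v::ab_group_add \<Rightarrow> 'v) \<Rightarrow> 'g set \<Rightarrow> ('g \<Rightarrow> 'v \<Rightarrow> 'v) \<Rightarrow> ('v, 'k) mpoly set set"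
  where "sym_invariants scale G \<rho> =
    {A \<in> carrier (sym_algebra scale). \<forall>g\<in>G. sym_map scale (\<rho> g) A = A}"

text \<open>\<open>B\<close> is finitely generated as an algebra over the subring \<open>K\<close> of
  \<open>S\<close>.\<close>

definition finitely_generated_algebra :: "('a, 'b) ring_scheme \<Rightarrow> 'a set \<Rightarrow> 'a set \<Rightarrow> bool"
  where "finitely_generated_algebra S K B \<longleftrightarrow>
    (\<exists>F. finite F \<and> F \<subseteq> B \<and> B = generate_ring S (K \<union> F))"

end

theory Submission
  imports Defs
begin

text \<open>
  The theorem follows Hilbert's proof of the finiteness of invariants, with the Omega-process in the
  role of the integral over a compact group.

  Let \<open>0\<close> be the zero element of the monoid. Evaluating the \<open>s\<close>-th power of the process at \<open>0\<close>
  gives a linear functional \<open>eps s\<close> on functions on the monoid. A translation by \<open>h\<close> multiplies it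
  by \<open>\<chi> h ^ s\<close>, because \<open>0\<close> absorbs translations (\<open>eps_rtrans\<close>), and its value at \<open>\<chi> ^ s\<close> is
  nonzero, because the process is proper (\<open>eps_char_power\<close>). Hence \<open>f / \<chi> ^ s \<mapsto> eps s f\<close> is, for
  each \<open>s\<close>, an invariant functional on functions of this form on the unit group. If \<open>s\<close> is large
  enough for an element \<open>p\<close> of \<open>S(V)\<close>, applying it to the coefficients of \<open>g \<mapsto> g \<cdot> p\<close> gives
  an invariant. This averaging is linear over the invariants. So if an invariant is a combination of
  invariants with arbitrary coefficients, it is also one with invariant coefficients
  (\<open>invariant_coefficients\<close>).

  For this the coefficients of \<open>g \<mapsto> g \<cdot> p\<close> have to be fractions of functions on the monoid with
  a power of \<open>\<chi>\<close> as denominator. They are regular functions on the principal open set where \<open>\<chi>\<close>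
  does not vanish, and such functions have this form by the Nullstellensatz
  (\<open>regular_on_principal_open\<close>). The Nullstellensatz is obtained by extending homomorphisms from a
  subring \<open>A\<close> to \<open>A[x]\<close> (\<open>extend_hom\<close>), adjoining one variable at a time.

  The ideal generated by the homogeneous invariants of positive degree is finitely generated by the
  Hilbert basis theorem (\<open>hilbert_basis_adjoin\<close>). Its finitely many homogeneous generators
  generate the algebra of invariants, by induction on the degree
  (\<open>graded_subalgebra_generated\<close>).

  The symmetric algebra is a quotient of a polynomial ring with one variable for each vector. All
  arguments take place in this polynomial ring, where each coset has a unique representative
  involving only the basis vectors (\<open>sym_class_eq_iff_proj\<close>).
\<close>

hide_const (open) up_ring.coeff up_ring.monom module.smult

section \<open>Adjoining an element to a subring\<close>

definition subring_set :: "'r::comm_ring_1 set \<Rightarrow> bool"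
  where "subring_set A \<longleftrightarrow> 0 \<in> A \<and> 1 \<in> A \<and>
    (\<forall>a\<in>A. \<forall>b\<in>A. a + b \<in> A \<and> a * b \<in> A) \<and> (\<forall>a\<in>A. - a \<in> A)"

lemma subring_setD:
  assumes "subring_set A"
  shows "0 \<in> A" "1 \<in> A" "a \<in> A \<Longrightarrow> b \<in> A \<Longrightarrow> a + b \<in> A"
    "a \<in> A \<Longrightarrow> b \<in> A \<Longrightarrow> a * b \<in> A" "a \<in> A \<Longrightarrow> - a \<in> A"
    "a \<in> A \<Longrightarrow> b \<in> A \<Longrightarrow> a - b \<in> A"
proof -
  show *: "a \<in> A \<Longrightarrow> b \<in> A \<Longrightarrow> a + b \<in> A" "a \<in> A \<Longrightarrow> - a \<in> A" for a b
    using assms by (auto simp: subring_set_def)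
  show "a \<in> A \<Longrightarrow> b \<in> A \<Longrightarrow> a - b \<in> A"
    using *(1)[of a "- b"] *(2)[of b] by simp
qed (use assms in \<open>auto simp: subring_set_def\<close>)

lemma subring_set_sum: "subring_set A \<Longrightarrow> (\<And>i. i \<in> I \<Longrightarrow> f i \<in> A) \<Longrightarrow> sum f I \<in> A"
  by (induction I rule: infinite_finite_induct) (auto simp: subring_setD)

lemma subring_set_power: "subring_set A \<Longrightarrow> a \<in> A \<Longrightarrow> a ^ n \<in> A"
  by (induction n) (auto simp: subring_setD)

definition polys_over :: "'r::comm_ring_1 set \<Rightarrow> 'r poly set"
  where "polys_over A = {p. \<forall>i. coeff p i \<in> A}"

lemma polys_overD: "p \<in> polys_over A \<Longrightarrow> coeff p i \<in> A"
  by (simp add: polys_over_def)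

lemma subring_polys_over:
  assumes "subring_set A" shows "subring_set (polys_over A)"
  using assms unfolding subring_set_def[of "polys_over A"]
  by (auto simp: polys_over_def coeff_mult coeff_1 subring_setD intro!: subring_set_sum)

lemma polys_over_monom: "subring_set A \<Longrightarrow> a \<in> A \<Longrightarrow> monom a n \<in> polys_over A"
  by (auto simp: polys_over_def coeff_monom subring_setD)

lemma polys_over_const: "subring_set A \<Longrightarrow> a \<in> A \<Longrightarrow> [:a:] \<in> polys_over A"
  using polys_over_monom[of A a 0] by (simp add: monom_0)

lemma polys_over_smult: "subring_set A \<Longrightarrow> a \<in> A \<Longrightarrow> p \<in> polys_over A \<Longrightarrow> smult a p \<in> polys_over A"
  by (auto simp: polys_over_def subring_setD)

definition adjoin :: "'r::comm_ring_1 set \<Rightarrow> 'r \<Rightarrow> 'r set"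
  where "adjoin A x = (\<lambda>p. poly p x) ` polys_over A"

lemma subring_adjoin:
  assumes "subring_set A" shows "subring_set (adjoin A x)"
proof -
  note P = subring_setD[OF subring_polys_over[OF assms]]
  have "0 \<in> adjoin A x" "1 \<in> adjoin A x"
    unfolding adjoin_def by (rule image_eqI[OF _ P(1)], simp) (rule image_eqI[OF _ P(2)], simp)
  moreover have "poly p x + poly q x \<in> adjoin A x" "poly p x * poly q x \<in> adjoin A x"
    "- poly p x \<in> adjoin A x" if "p \<in> polys_over A" "q \<in> polys_over A" for p q
    unfolding adjoin_def using that
    by (auto intro: image_eqI[OF _ P(3)] image_eqI[OF _ P(4)] image_eqI[OF _ P(5)])
  ultimately show ?thesis unfolding subring_set_def by (auto simp: adjoin_def)
qed

lemma adjoin_base: "subring_set A \<Longrightarrow> a \<in> A \<Longrightarrow> a \<in> adjoin A x"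
  unfolding adjoin_def by (rule image_eqI[OF _ polys_over_const]) auto

lemma adjoin_elem: "subring_set A \<Longrightarrow> x \<in> adjoin A x"
  unfolding adjoin_def
  by (rule image_eqI[OF _ polys_over_monom[of A 1 1]]) (auto simp: poly_monom subring_setD)

fun adjoin_list :: "'r::comm_ring_1 set \<Rightarrow> 'r list \<Rightarrow> 'r set"
  where "adjoin_list A [] = A"
  | "adjoin_list A (x # xs) = adjoin (adjoin_list A xs) x"

lemma subring_adjoin_list: "subring_set A \<Longrightarrow> subring_set (adjoin_list A xs)"
  by (induction xs) (auto simp: subring_adjoin)

lemma adjoin_list_base: "subring_set A \<Longrightarrow> a \<in> A \<Longrightarrow> a \<in> adjoin_list A xs"
  by (induction xs) (auto simp: subring_adjoin_list adjoin_base)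

lemma adjoin_list_elem: "subring_set A \<Longrightarrow> x \<in> set xs \<Longrightarrow> x \<in> adjoin_list A xs"
  by (induction xs) (auto simp: subring_adjoin_list adjoin_base adjoin_elem)


section \<open>The Hilbert basis theorem\<close>

inductive_set ideal_span :: "'r::comm_ring_1 set \<Rightarrow> 'r set \<Rightarrow> 'r set" for A S
  where zero: "0 \<in> ideal_span A S"
  | step: "a \<in> A \<Longrightarrow> s \<in> S \<Longrightarrow> y \<in> ideal_span A S \<Longrightarrow> a * s + y \<in> ideal_span A S"

lemma ideal_span_add: "x \<in> ideal_span A S \<Longrightarrow> y \<in> ideal_span A S \<Longrightarrow> x + y \<in> ideal_span A S"
  by (induction rule: ideal_span.induct) (auto simp: add.assoc intro: ideal_span.step)

lemma ideal_span_mult: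
  "subring_set A \<Longrightarrow> c \<in> A \<Longrightarrow> x \<in> ideal_span A S \<Longrightarrow> c * x \<in> ideal_span A S"
  by (rotate_tac 2, induction rule: ideal_span.induct)
    (auto simp: distrib_left mult.assoc[symmetric] subring_setD intro: ideal_span.intros)

lemma ideal_span_incl: "subring_set A \<Longrightarrow> s \<in> S \<Longrightarrow> s \<in> ideal_span A S"
  using ideal_span.step[of 1 A s S 0] by (simp add: ideal_span.zero subring_setD)

lemma ideal_span_minus: "subring_set A \<Longrightarrow> x \<in> ideal_span A S \<Longrightarrow> - x \<in> ideal_span A S"
  using ideal_span_mult[of A "-1" x S] by (simp add: subring_setD)

lemma ideal_span_least:
  assumes "subring_set A" "S \<subseteq> ideal_span A T"
  shows "ideal_span A S \<subseteq> ideal_span A T"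
proof
  show "x \<in> ideal_span A T" if "x \<in> ideal_span A S" for x
    using that assms
    by (induction) (auto intro!: ideal_span.zero ideal_span_add ideal_span_mult)
qed

lemma ideal_span_mono: "S \<subseteq> T \<Longrightarrow> ideal_span A S \<subseteq> ideal_span A T"
proof
  show "x \<in> ideal_span A T" if "S \<subseteq> T" "x \<in> ideal_span A S" for x
    using that(2,1) by induction (auto intro: ideal_span.intros)
qed

lemma ideal_span_subset: "subring_set A \<Longrightarrow> S \<subseteq> A \<Longrightarrow> ideal_span A S \<subseteq> A"
proof
  show "x \<in> A" if "subring_set A" "S \<subseteq> A" "x \<in> ideal_span A S" for x
    using that(3,1,2) by induction (auto simp: subring_setD subset_iff)
qed

lemma ideal_span_finite_support:
  "x \<in> ideal_span A S \<Longrightarrow> \<exists>F. finite F \<and> F \<subseteq> S \<and> x \<in> ideal_span A F"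
proof (induction rule: ideal_span.induct)
  case zero
  show ?case by (intro exI[of _ "{}"]) (auto intro: ideal_span.zero)
next
  case (step a s y)
  then obtain F where F: "finite F" "F \<subseteq> S" "y \<in> ideal_span A F" by blast
  have "y \<in> ideal_span A (insert s F)" using F(3) ideal_span_mono[of F "insert s F"] by blast
  then show ?case
    using F step by (intro exI[of _ "insert s F"]) (auto intro: ideal_span.step)
qed

text \<open>Repeated occurrences of a generator in a linear combination are gathered, so that each generator
  has one coefficient.\<close>

lemma ideal_span_image_sum:
  assumes A: "subring_set A" and F: "finite F" and x: "x \<in> ideal_span A (f ` F)"
  shows "\<exists>a. (\<forall>s\<in>F. a s \<in> A) \<and> x = (\<Sum>s\<in>F. a s * f s)"
  using x
proof induction
  case zero
  show ?case by (intro exI[of _ "\<lambda>_. 0"]) (auto simp: subring_setD[OF A])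
next
  case (step c s y)
  then obtain a t where a: "\<forall>s\<in>F. a s \<in> A" "y = (\<Sum>s\<in>F. a s * f s)" and t: "t \<in> F" "s = f t"
    by blast
  have "(\<Sum>s\<in>F. (if s = t then c + a s else a s) * f s) = (\<Sum>s\<in>F. (if s = t then c * f s else 0) + a s * f s)"
    by (intro sum.cong) (auto simp: distrib_right)
  also have "\<dots> = c * s + y" using t F a by (simp add: sum.distrib)
  finally show ?case
    using a step t by (intro exI[of _ "\<lambda>s. if s = t then c + a s else a s"]) (auto simp: subring_setD[OF A])
qed

definition noetherian :: "'r::comm_ring_1 set \<Rightarrow> bool"
  where "noetherian A \<longleftrightarrow> (\<forall>S\<subseteq>A. \<exists>F\<subseteq>S. finite F \<and> S \<subseteq> ideal_span A F)"

lemma noetherian_field_image: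
  fixes h :: "'k::field \<Rightarrow> 'r::comm_ring_1"
  assumes "h 1 = 1" "\<And>a b. h (a * b) = h a * h b" "h 0 = 0"
  shows "noetherian (range h)"
  unfolding noetherian_def
proof (intro allI impI)
  fix S assume S: "S \<subseteq> range h"
  show "\<exists>F\<subseteq>S. finite F \<and> S \<subseteq> ideal_span (range h) F"
  proof (cases "S \<subseteq> {0}")
    case True
    then show ?thesis by (intro exI[of _ "{}"]) (auto intro: ideal_span.zero)
  next
    case False
    then obtain c where c: "h c \<in> S" "h c \<noteq> 0" using S by blast
    then have [simp]: "c \<noteq> 0" using assms(3) by auto
    have "h d \<in> ideal_span (range h) {h c}" for d
    proof -
      have "h (d / c) * h c + 0 \<in> ideal_span (range h) {h c}"
        by (intro ideal_span.intros) auto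
      then show ?thesis by (simp flip: assms(2))
    qed
    then show ?thesis using c S by (intro exI[of _ "{h c}"]) blast
  qed
qed

text \<open>Otherwise some ideal admits an infinite sequence of elements, each of minimal degree among the
  elements of the ideal that its predecessors do not generate. The degrees then increase, and since
  the leading coefficients generate a finitely generated ideal, some leading coefficient is a
  combination of earlier ones. Subtracting the corresponding combination of earlier members of the
  sequence lowers the degree, which contradicts minimality.\<close>

lemma noetherian_polys_over:
  assumes A: "subring_set A" and noeth: "noetherian A"
  shows "noetherian (polys_over A)"
  unfolding noetherian_def
proof (intro allI impI)
  fix S assume S: "S \<subseteq> polys_over A"
  let ?R = "polys_over A"
  note R = subring_polys_over[OF A]
  have SR: "ideal_span ?R S \<subseteq> ?R" by (rule ideal_span_subset[OF R S])
  show "\<exists>F\<subseteq>S. finite F \<and> S \<subseteq> ideal_span ?R F"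
  proof (rule ccontr)
    assume nfg: "\<not> ?thesis"
    \<comment> \<open>Finitely many elements of the ideal involve only finitely many elements of \<open>S\<close>.\<close>
    have big: "\<exists>p\<in>ideal_span ?R S. p \<notin> ideal_span ?R (set ps)" if "set ps \<subseteq> ideal_span ?R S" for ps
    proof (rule ccontr)
      assume *: "\<not> ?thesis"
      have "\<forall>p\<in>set ps. \<exists>F. finite F \<and> F \<subseteq> S \<and> p \<in> ideal_span ?R F"
        using that ideal_span_finite_support by blast
      then obtain F where F: "\<forall>p\<in>set ps. finite (F p) \<and> F p \<subseteq> S \<and> p \<in> ideal_span ?R (F p)" by metis
      let ?F = "\<Union>p\<in>set ps. F p"
      have "ideal_span ?R (set ps) \<subseteq> ideal_span ?R ?F"
        using F ideal_span_mono[of "F _" ?F ?R] by (intro ideal_span_least[OF R]) blast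
      then have "S \<subseteq> ideal_span ?R ?F" using * ideal_span_incl[OF R] by blast
      moreover have "finite ?F" "?F \<subseteq> S" using F by auto
      ultimately show False using nfg by blast
    qed
    define nxt where "nxt ps = (ARG_MIN degree p. p \<in> ideal_span ?R S \<and> p \<notin> ideal_span ?R (set ps))" for ps
    define seq where "seq = rec_nat [] (\<lambda>_ ps. ps @ [nxt ps])"
    have seq_Suc: "seq (Suc n) = seq n @ [nxt (seq n)]" for n by (simp add: seq_def)
    define f where "f n = nxt (seq n)" for n
    have set_seq: "set (seq n) = f ` {..<n}" for n
      by (induction n) (auto simp: seq_Suc f_def lessThan_Suc, simp add: seq_def)
    have nxt: "nxt ps \<in> ideal_span ?R S" "nxt ps \<notin> ideal_span ?R (set ps)"
      "\<And>p. p \<in> ideal_span ?R S \<Longrightarrow> p \<notin> ideal_span ?R (set ps) \<Longrightarrow> degree (nxt ps) \<le> degree p"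
      if ps: "set ps \<subseteq> ideal_span ?R S" for ps
    proof -
      obtain p0 where "p0 \<in> ideal_span ?R S \<and> p0 \<notin> ideal_span ?R (set ps)"
        using big[OF ps] by blast
      from arg_min_natI[of "\<lambda>p. p \<in> ideal_span ?R S \<and> p \<notin> ideal_span ?R (set ps)", OF this, of degree]
      show "nxt ps \<in> ideal_span ?R S" "nxt ps \<notin> ideal_span ?R (set ps)" unfolding nxt_def by blast+
      show "degree (nxt ps) \<le> degree p" if "p \<in> ideal_span ?R S" "p \<notin> ideal_span ?R (set ps)" for p
        unfolding nxt_def by (rule arg_min_nat_le) (use that in blast)
    qed
    have sub: "set (seq n) \<subseteq> ideal_span ?R S" for n
    proof (induction n)
      case (Suc n)
      then show ?case using nxt(1)[OF Suc] by (simp add: seq_Suc)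
    qed (simp add: seq_def)
    have fI: "f n \<in> ideal_span ?R S \<and> f n \<notin> ideal_span ?R (f ` {..<n})" for n
      using nxt(1,2)[OF sub] unfolding f_def[symmetric] set_seq by blast
    have fmin: "degree (f n) \<le> degree p"
      if "p \<in> ideal_span ?R S" "p \<notin> ideal_span ?R (f ` {..<n})" for n p
      using nxt(3)[OF sub, of p n] that unfolding f_def[symmetric] set_seq by blast
    have mono: "degree (f i) \<le> degree (f n)" if "i \<le> n" for i n
    proof -
      have "f ` {..<i} \<subseteq> f ` {..<n}" using that by (intro image_mono) simp
      from ideal_span_mono[OF this] show ?thesis using fI[of n] by (intro fmin) blast+
    qed
    have lead: "lead_coeff (f n) \<in> A" for n using fI SR polys_overD by blast
    then have "range (\<lambda>n. lead_coeff (f n)) \<subseteq> A" by blast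
    then obtain F where F: "F \<subseteq> range (\<lambda>n. lead_coeff (f n))" "finite F"
      "range (\<lambda>n. lead_coeff (f n)) \<subseteq> ideal_span A F" using noeth unfolding noetherian_def by meson
    from finite_subset_image[OF F(2,1)] obtain N where N: "finite N" "F = (\<lambda>n. lead_coeff (f n)) ` N" by blast
    define m where "m = Suc (Max (insert 0 N))"
    have Nm: "i < m" if "i \<in> N" for i using N(1) that by (simp add: m_def less_Suc_eq_le)
    have "lead_coeff (f m) \<in> ideal_span A ((\<lambda>n. lead_coeff (f n)) ` N)" using F(3) N(2) by blast
    from ideal_span_image_sum[OF A N(1) this] obtain a where
      a: "\<forall>i\<in>N. a i \<in> A" "lead_coeff (f m) = (\<Sum>i\<in>N. a i * lead_coeff (f i))" by blast
    \<comment> \<open>The powers of the variable bring all earlier members to the degree of \<open>f m\<close>, so that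
      \<open>g\<close> has the leading term of \<open>f m\<close>.\<close>
    define g where "g = (\<Sum>i\<in>N. monom (a i) (degree (f m) - degree (f i)) * f i)"
    have gspan: "g \<in> ideal_span ?R (f ` {..<m})"
    proof -
      have sum_in: "sum h I \<in> ideal_span ?R T" if "\<And>i. i \<in> I \<Longrightarrow> h i \<in> ideal_span ?R T" for h :: "nat \<Rightarrow> _" and I T
        using that by (induction I rule: infinite_finite_induct) (auto intro: ideal_span.zero ideal_span_add)
      have "monom (a i) (degree (f m) - degree (f i)) * f i \<in> ideal_span ?R (f ` {..<m})"
        if "i \<in> N" for i
        using that a Nm by (intro ideal_span_mult[OF R] polys_over_monom[OF A] ideal_span_incl[OF R]) auto
      then show ?thesis unfolding g_def by (rule sum_in)
    qed
    have degt: "degree (monom (a i) (degree (f m) - degree (f i)) * f i) \<le> degree (f m)" if "i \<in> N" for i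
    proof -
      have "degree (monom (a i) (degree (f m) - degree (f i)) * f i) \<le> (degree (f m) - degree (f i)) + degree (f i)"
        by (rule order.trans[OF degree_mult_le]) (simp add: degree_monom_le)
      then show ?thesis using mono[of i m] Nm[OF that] by simp
    qed
    have degg: "degree g \<le> degree (f m)" unfolding g_def by (intro degree_sum_le N degt)
    have cg: "coeff g (degree (f m)) = lead_coeff (f m)"
      unfolding g_def a(2) coeff_sum
    proof (intro sum.cong refl)
      fix i assume "i \<in> N"
      then have "degree (f i) \<le> degree (f m)" using mono[of i m] Nm[of i] by simp
      then show "coeff (monom (a i) (degree (f m) - degree (f i)) * f i) (degree (f m)) = a i * lead_coeff (f i)"
        by (simp add: coeff_monom_mult)
    qed
    have "f m - g \<in> ideal_span ?R S"
    proof -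
      have "f ` {..<m} \<subseteq> ideal_span ?R S" using fI by blast
      from ideal_span_least[OF R this] have "g \<in> ideal_span ?R S" using gspan by blast
      then show ?thesis using ideal_span_add[OF _ ideal_span_minus[OF R], of "f m" S g] fI by simp
    qed
    moreover have notin: "f m - g \<notin> ideal_span ?R (f ` {..<m})"
      using ideal_span_add[OF _ gspan, of "f m - g"] fI[of m] by auto
    ultimately have le: "degree (f m) \<le> degree (f m - g)" by (rule fmin)
    have "degree (f m - g) \<le> degree (f m)" using degg degree_diff_le by blast
    with le have "degree (f m - g) = degree (f m)" by simp
    then have "lead_coeff (f m - g) = 0" using cg by simp
    then have "f m - g = 0" by (simp only: leading_coeff_0_iff)
    with notin ideal_span.zero[of ?R "f ` {..<m}"] show False by simp
  qed
qed

text \<open>The ring \<open>A[x]\<close> is the image of the polynomial ring over \<open>A\<close> under evaluation at \<open>x\<close>.\<close>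

theorem hilbert_basis_adjoin:
  assumes A: "subring_set A" and noeth: "noetherian A"
  shows "noetherian (adjoin A x)"
  unfolding noetherian_def
proof (intro allI impI)
  fix S assume "S \<subseteq> adjoin A x"
  then obtain T where T: "T \<subseteq> polys_over A" "S = (\<lambda>p. poly p x) ` T"
    unfolding adjoin_def by (meson subset_imageE)
  obtain F where F: "F \<subseteq> T" "finite F" "T \<subseteq> ideal_span (polys_over A) F"
    using noetherian_polys_over[OF assms] T(1) unfolding noetherian_def by meson
  have "poly p x \<in> ideal_span (adjoin A x) ((\<lambda>p. poly p x) ` F)"
    if "p \<in> ideal_span (polys_over A) F" for p
    using that by induction (auto simp: adjoin_def intro: ideal_span.intros)
  then show "\<exists>F\<subseteq>S. finite F \<and> S \<subseteq> ideal_span (adjoin A x) F"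
    using F T by (intro exI[of _ "(\<lambda>p. poly p x) ` F"]) blast
qed

corollary noetherian_adjoin_list:
  "subring_set A \<Longrightarrow> noetherian A \<Longrightarrow> noetherian (adjoin_list A xs)"
  by (induction xs) (auto simp: hilbert_basis_adjoin subring_adjoin_list)


section \<open>Extension of homomorphisms\<close>

text \<open>The quotient by a prime ideal would be a new type. Here the domain is represented by the ambient
  ring together with the prime ideal \<open>P\<close>, and membership in \<open>P\<close> plays the role of vanishing.\<close>

definition prime_set :: "'r::comm_ring_1 set \<Rightarrow> bool"
  where "prime_set P \<longleftrightarrow> 0 \<in> P \<and> 1 \<notin> P \<and> (\<forall>a\<in>P. \<forall>b\<in>P. a + b \<in> P) \<and>
    (\<forall>r. \<forall>a\<in>P. r * a \<in> P) \<and> (\<forall>a b. a * b \<in> P \<longrightarrow> a \<in> P \<or> b \<in> P)"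

lemma prime_setD:
  assumes "prime_set P"
  shows "0 \<in> P" "1 \<notin> P" "a \<in> P \<Longrightarrow> b \<in> P \<Longrightarrow> a + b \<in> P" "a \<in> P \<Longrightarrow> r * a \<in> P"
    "a \<in> P \<Longrightarrow> a * r \<in> P" "a * b \<in> P \<longleftrightarrow> a \<in> P \<or> b \<in> P" "- a \<in> P \<longleftrightarrow> a \<in> P"
    "a \<in> P \<Longrightarrow> b \<in> P \<Longrightarrow> a - b \<in> P"
proof -
  show *: "0 \<in> P" "1 \<notin> P" "\<And>a b. a \<in> P \<Longrightarrow> b \<in> P \<Longrightarrow> a + b \<in> P" "\<And>a r. a \<in> P \<Longrightarrow> r * a \<in> P"
    using assms by (auto simp: prime_set_def)
  show "a \<in> P \<Longrightarrow> a * r \<in> P" using *(4)[of a r] by (simp add: mult.commute)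
  show "a * b \<in> P \<longleftrightarrow> a \<in> P \<or> b \<in> P"
    using assms unfolding prime_set_def by (metis mult.commute)
  have neg: "\<And>a. a \<in> P \<Longrightarrow> - a \<in> P" using *(4)[of _ "- 1"] by simp
  show "- a \<in> P \<longleftrightarrow> a \<in> P" using neg[of a] neg[of "- a"] by auto
  show "a \<in> P \<Longrightarrow> b \<in> P \<Longrightarrow> a - b \<in> P" using *(3)[of a "- b"] neg[of b] by simp
qed

lemma prime_set_sum: "prime_set P \<Longrightarrow> (\<And>i. i \<in> I \<Longrightarrow> f i \<in> P) \<Longrightarrow> sum f I \<in> P"
  by (induction I rule: infinite_finite_induct) (auto simp: prime_setD)

lemma prime_set_power: "prime_set P \<Longrightarrow> a \<notin> P \<Longrightarrow> a ^ n \<notin> P"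
  by (induction n) (auto simp: prime_setD)

lemma poly_in_prime_set:
  assumes "prime_set P" "\<And>i. coeff p i \<in> P" shows "poly p x \<in> P"
  unfolding poly_altdef by (intro prime_set_sum assms prime_setD(5)[OF assms(1)])

text \<open>The homomorphisms from \<open>A\<close> that factor through \<open>A\<close> modulo \<open>P\<close>; only the values on \<open>A\<close> matter.\<close>

definition hom_on :: "'r::comm_ring_1 set \<Rightarrow> 'r set \<Rightarrow> ('r \<Rightarrow> 'k::comm_ring_1) \<Rightarrow> bool"
  where "hom_on A P \<phi> \<longleftrightarrow> \<phi> 1 = 1 \<and> (\<forall>a\<in>A. \<forall>b\<in>A. \<phi> (a + b) = \<phi> a + \<phi> b \<and> \<phi> (a * b) = \<phi> a * \<phi> b) \<and>
    (\<forall>a\<in>A \<inter> P. \<phi> a = 0)"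

lemma hom_onD:
  assumes "hom_on A P \<phi>"
  shows "\<phi> 1 = 1" "a \<in> A \<Longrightarrow> b \<in> A \<Longrightarrow> \<phi> (a + b) = \<phi> a + \<phi> b"
    "a \<in> A \<Longrightarrow> b \<in> A \<Longrightarrow> \<phi> (a * b) = \<phi> a * \<phi> b" "a \<in> A \<Longrightarrow> a \<in> P \<Longrightarrow> \<phi> a = 0"
  using assms by (auto simp: hom_on_def)

text \<open>Division with remainder by a polynomial whose leading coefficient need not be a unit, at
  the price of a power of that coefficient. The bound on the degree of the quotient has to be
  stated because the ambient ring may have zero divisors.\<close>

lemma pseudo_division_over:
  assumes A: "subring_set A" and p: "p \<in> polys_over A" "degree p = n" "n > 0"
    and q: "q \<in> polys_over A" "degree q < n + d"
  shows "\<exists>k s r. s \<in> polys_over A \<and> r \<in> polys_over A \<and>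
    smult (lead_coeff p ^ k) q = s * p + r \<and> degree r < n \<and> (s = 0 \<or> degree s < d)"
  using q
proof (induction d arbitrary: q)
  case 0
  then show ?case
    by (intro exI[of _ 0] exI[of _ q]) (auto simp: subring_setD subring_polys_over[OF A])
next
  case (Suc d)
  note R = subring_setD[OF subring_polys_over[OF A]]
  show ?case
  proof (cases "degree q < n + d")
    case True
    from Suc.IH[OF Suc.prems(1) this] show ?thesis using less_SucI[of _ d] by blast
  next
    case False
    then have deg: "degree q = n + d" using Suc.prems by simp
    let ?a = "lead_coeff p"
    let ?m = "monom (lead_coeff q) d"
    define q' where "q' = smult ?a q - ?m * p"
    have a: "?a \<in> A" "lead_coeff q \<in> A" using p Suc.prems polys_overD by blast+
    have m: "?m \<in> polys_over A" using polys_over_monom[OF A] a by blast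
    have q': "q' \<in> polys_over A" unfolding q'_def
      by (intro R polys_over_smult A a m p Suc.prems)
    have "degree (?m * p) \<le> d + n"
      by (rule order.trans[OF degree_mult_le]) (simp add: p degree_monom_le)
    then have "degree q' \<le> n + d" unfolding q'_def
      using deg degree_smult_le[of ?a q] by (intro degree_diff_le) simp_all
    moreover have "coeff q' (n + d) = 0"
    proof -
      have "coeff (?m * p) (n + d) = lead_coeff q * lead_coeff p"
        by (simp add: coeff_monom_mult p)
      then show ?thesis unfolding q'_def using deg by (simp add: mult.commute)
    qed
    ultimately have "degree q' < n + d"
      using p(3) by (metis add_gr_0 coeff_0_degree_minus_1 degree_0 le_degree leading_coeff_0_iff le_neq_implies_less)
    from Suc.IH[OF q' this] obtain k s r where ksr: "s \<in> polys_over A" "r \<in> polys_over A"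
      "smult (?a ^ k) q' = s * p + r" "degree r < n" "s = 0 \<or> degree s < d" by blast
    have "smult (?a ^ Suc k) q = (s + smult (?a ^ k) ?m) * p + r"
      using ksr(3) by (simp add: q'_def algebra_simps smult_diff_right)
    moreover have "s + smult (?a ^ k) ?m \<in> polys_over A"
      by (intro R ksr polys_over_smult A m subring_set_power a)
    moreover have "degree (s + smult (?a ^ k) ?m) < Suc d"
    proof -
      have "degree (smult (?a ^ k) ?m) \<le> d"
        using degree_smult_le degree_monom_le order.trans by blast
      then have "degree (s + smult (?a ^ k) ?m) \<le> d" using ksr(5) by (intro degree_add_le) auto
      then show ?thesis by simp
    qed
    ultimately show ?thesis using ksr(2,4) by blast
  qed
qed

text \<open>Coefficients in the prime ideal are zero modulo it, so the top ones are dropped until the leading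
  coefficient is nonzero modulo the ideal.\<close>

lemma truncate_mod_prime:
  assumes A: "subring_set A" and P: "prime_set P" and q: "q \<in> polys_over A" "\<exists>i. coeff q i \<notin> P"
  shows "\<exists>q'\<in>polys_over A. lead_coeff q' \<notin> P \<and> degree q' \<le> degree q \<and> poly q x - poly q' x \<in> P"
proof -
  define j where "j = Max {i. coeff q i \<notin> P}"
  have fin: "finite {i. coeff q i \<notin> P}"
    by (rule finite_subset[of _ "{..degree q}"]) (auto intro: le_degree simp: prime_setD(1)[OF P])
  have j: "coeff q j \<notin> P" unfolding j_def using Max_in[OF fin] q(2) by blast
  have above: "coeff q i \<in> P" if "i > j" for i
    using Max_ge[OF fin, of i] that unfolding j_def by (meson mem_Collect_eq not_le)
  define q' where "q' = (\<Sum>i\<le>j. monom (coeff q i) i)"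
  have cq': "coeff q' i = (if i \<le> j then coeff q i else 0)" for i
    by (auto simp: q'_def coeff_sum coeff_monom)
  have dq': "degree q' = j"
  proof (rule antisym)
    show "degree q' \<le> j" by (rule degree_le) (simp add: cq')
    show "j \<le> degree q'" by (rule le_degree) (use j prime_setD(1)[OF P] in \<open>auto simp: cq'\<close>)
  qed
  have "poly (q - q') x \<in> P"
    by (rule poly_in_prime_set[OF P]) (use above prime_setD(1)[OF P] in \<open>auto simp: cq'\<close>)
  moreover have "q' \<in> polys_over A"
    using q(1) subring_setD(1)[OF A] by (auto simp: polys_over_def cq')
  moreover have "j \<le> degree q" using j prime_setD(1)[OF P] by (intro le_degree) auto
  ultimately show ?thesis using j by (intro bexI[of _ q']) (auto simp: dq' cq')
qed

lemma map_poly_hom_on: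
  assumes A: "subring_set A" and P: "prime_set P" and h: "hom_on A P \<phi>"
    and pq: "p \<in> polys_over A" "q \<in> polys_over A"
  shows "map_poly \<phi> (p + q) = map_poly \<phi> p + map_poly \<phi> q"
    and "map_poly \<phi> (p * q) = map_poly \<phi> p * map_poly \<phi> q"
proof -
  note R = subring_setD[OF A] and H = hom_onD[OF h]
  have z: "\<phi> 0 = 0" using H(4)[of 0] R prime_setD[OF P] by blast
  have c: "coeff p i \<in> A" "coeff q i \<in> A" for i using pq polys_overD by blast+
  have sum: "\<phi> (sum f I) = (\<Sum>i\<in>I. \<phi> (f i))" if "\<And>i. f i \<in> A" for f :: "nat \<Rightarrow> _" and I
    by (induction I rule: infinite_finite_induct) (auto simp: z H that subring_set_sum[OF A])
  show "map_poly \<phi> (p + q) = map_poly \<phi> p + map_poly \<phi> q"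
    by (rule poly_eqI) (simp add: coeff_map_poly z H c)
  show "map_poly \<phi> (p * q) = map_poly \<phi> p * map_poly \<phi> q"
    by (rule poly_eqI) (simp add: coeff_map_poly z coeff_mult sum R c H)
qed

text \<open>Sending \<open>x\<close> to \<open>\<xi>\<close> defines an extension of \<open>\<phi>\<close> as soon as the polynomials that
  vanish at \<open>x\<close> modulo the prime ideal are mapped to polynomials that vanish at \<open>\<xi>\<close>.\<close>

lemma extend_hom_by_value:
  assumes A: "subring_set A" and P: "prime_set P" and h: "hom_on A P \<phi>"
    and kill: "\<And>q. q \<in> polys_over A \<Longrightarrow> poly q x \<in> P \<Longrightarrow> poly (map_poly \<phi> q) \<xi> = 0"
  obtains \<psi> where "hom_on (adjoin A x) P \<psi>" "\<And>a. a \<in> A \<Longrightarrow> \<psi> a = \<phi> a"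
    "\<And>q. q \<in> polys_over A \<Longrightarrow> \<psi> (poly q x) = poly (map_poly \<phi> q) \<xi>"
proof -
  define \<psi> where "\<psi> y = poly (map_poly \<phi> (SOME q. q \<in> polys_over A \<and> poly q x = y)) \<xi>" for y
  note R = subring_setD[OF A] and H = hom_onD[OF h]
    and RP = subring_setD[OF subring_polys_over[OF A]]
  have z: "\<phi> 0 = 0" using H(4)[of 0] R prime_setD[OF P] by blast
  have \<psi>: "\<psi> (poly q x) = poly (map_poly \<phi> q) \<xi>" if q: "q \<in> polys_over A" for q
  proof -
    define q' where "q' = (SOME q'. q' \<in> polys_over A \<and> poly q' x = poly q x)"
    have q': "q' \<in> polys_over A \<and> poly q' x = poly q x"
      unfolding q'_def by (rule someI[of _ q]) (use q in simp)
    have "poly (map_poly \<phi> (q' - q)) \<xi> = 0"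
      by (rule kill) (use q q' RP in \<open>auto simp: prime_setD[OF P]\<close>)
    moreover have "map_poly \<phi> q' = map_poly \<phi> (q' - q) + map_poly \<phi> q"
      using map_poly_hom_on(1)[OF A P h RP(6), of q' q q] q q' by simp
    ultimately show ?thesis by (simp add: \<psi>_def flip: q'_def)
  qed
  have base: "\<psi> a = \<phi> a" if "a \<in> A" for a
    using \<psi>[OF polys_over_const[OF A that]] by (simp add: map_poly_pCons z)
  have "hom_on (adjoin A x) P \<psi>"
    unfolding hom_on_def
  proof (intro conjI ballI)
    show "\<psi> 1 = 1" using base[of 1] R H by simp
  next
    fix a b assume "a \<in> adjoin A x" "b \<in> adjoin A x"
    then obtain p q where pq: "p \<in> polys_over A" "q \<in> polys_over A" and [simp]: "a = poly p x" "b = poly q x"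
      by (auto simp: adjoin_def)
    show "\<psi> (a + b) = \<psi> a + \<psi> b"
      using \<psi>[OF RP(3)[OF pq]] by (simp add: \<psi> pq map_poly_hom_on[OF A P h pq])
    show "\<psi> (a * b) = \<psi> a * \<psi> b"
      using \<psi>[OF RP(4)[OF pq]] by (simp add: \<psi> pq map_poly_hom_on[OF A P h pq])
  next
    fix a assume "a \<in> adjoin A x \<inter> P"
    then show "\<psi> a = 0" using \<psi> kill by (auto simp: adjoin_def)
  qed
  with base \<psi> show thesis using that by blast
qed

text \<open>This is the step from \<open>A\<close> to \<open>A[x]\<close> in Chevalley's extension theorem: after inverting a suitable
  element \<open>c\<close> of \<open>A\<close>, every homomorphism to an algebraically closed field extends without killing \<open>f\<close>.

  If \<open>x\<close> is transcendental, \<open>c\<close> is a coefficient of a polynomial representing \<open>f\<close>, and \<open>x\<close> is sent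
  to a point that is not a root of the image of this polynomial. If \<open>x\<close> is algebraic, with a relation \<open>p\<close>
  of minimal degree, then \<open>x\<close> is sent to a root of the image of \<open>p\<close>; this is well defined if the
  leading coefficient of \<open>p\<close> survives, since division by \<open>p\<close> then controls all relations. Moreover
  \<open>f\<close> divides a nonzero element \<open>c0\<close> of \<open>A\<close>, so \<open>f\<close> is not killed if \<open>c0\<close> survives.\<close>

lemma extend_hom:
  fixes A :: "'r::comm_ring_1 set"
  assumes A: "subring_set A" and P: "prime_set P" and f: "f \<in> adjoin A x" "f \<notin> P"
  shows "\<exists>c\<in>A. c \<notin> P \<and> (\<forall>\<phi> :: 'r \<Rightarrow> 'k::{alg_closed_field, field_char_0}. hom_on A P \<phi> \<longrightarrow> \<phi> c \<noteq> 0 \<longrightarrow>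
    (\<exists>\<psi>. hom_on (adjoin A x) P \<psi> \<and> (\<forall>a\<in>A. \<psi> a = \<phi> a) \<and> \<psi> f \<noteq> 0))"
proof -
  note R = subring_setD[OF A] and RP = subring_setD[OF subring_polys_over[OF A]] and PD = prime_setD[OF P]
  obtain q where q: "q \<in> polys_over A" and fq: "f = poly q x" using f(1) by (auto simp: adjoin_def)
  have zero: "\<phi> 0 = 0" if "hom_on A P \<phi>" for \<phi> :: "'r \<Rightarrow> 'k"
    using hom_onD(4)[OF that, of 0] R PD by blast
  show ?thesis
  proof (cases "\<exists>p\<in>polys_over A. poly p x \<in> P \<and> (\<exists>i. coeff p i \<notin> P)")
    case False
    \<comment> \<open>Here \<open>x\<close> is transcendental modulo \<open>P\<close>, and any value that is not a root works.\<close>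
    then have tr: "coeff p i \<in> P" if "p \<in> polys_over A" "poly p x \<in> P" for p i using that by blast
    have "\<exists>j. coeff q j \<notin> P" using poly_in_prime_set[OF P] f(2) fq by blast
    then obtain j where j: "coeff q j \<notin> P" ..
    show ?thesis
    proof (intro bexI[of _ "coeff q j"] conjI j allI impI)
      show "coeff q j \<in> A" using q by (rule polys_overD)
      fix \<phi> :: "'r \<Rightarrow> 'k" assume h: "hom_on A P \<phi>" and nz: "\<phi> (coeff q j) \<noteq> 0"
      have "coeff (map_poly \<phi> q) j \<noteq> 0" using nz by (simp add: coeff_map_poly zero[OF h])
      then have "map_poly \<phi> q \<noteq> 0" by auto
      then have "finite {\<xi>. poly (map_poly \<phi> q) \<xi> = 0}" by (rule poly_roots_finite)
      then obtain \<xi> where \<xi>: "poly (map_poly \<phi> q) \<xi> \<noteq> 0"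
        using ex_new_if_finite[OF infinite_UNIV_char_0] by blast
      have "poly (map_poly \<phi> p) \<xi> = 0" if p: "p \<in> polys_over A" "poly p x \<in> P" for p
      proof -
        have "\<phi> (coeff p i) = 0" for i
          using hom_onD(4)[OF h polys_overD[OF p(1)]] tr[OF p] by blast
        then have "map_poly \<phi> p = 0" by (intro poly_eqI) (simp add: coeff_map_poly zero[OF h])
        then show ?thesis by simp
      qed
      from extend_hom_by_value[OF A P h this] obtain \<psi> where
        "hom_on (adjoin A x) P \<psi>" "\<And>a. a \<in> A \<Longrightarrow> \<psi> a = \<phi> a"
        "\<And>q. q \<in> polys_over A \<Longrightarrow> \<psi> (poly q x) = poly (map_poly \<phi> q) \<xi>" by metis
      then show "\<exists>\<psi>. hom_on (adjoin A x) P \<psi> \<and> (\<forall>a\<in>A. \<psi> a = \<phi> a) \<and> \<psi> f \<noteq> 0"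
        using \<xi> q fq by metis
    qed
  next
    case True
    \<comment> \<open>Here \<open>x\<close> is algebraic modulo \<open>P\<close>; let \<open>p\<close> be a relation of minimal degree.\<close>
    let ?rel = "\<lambda>p. p \<in> polys_over A \<and> poly p x \<in> P \<and> lead_coeff p \<notin> P"
    have trunc: "\<exists>p'. ?rel p' \<and> degree p' \<le> degree p"
      if p: "p \<in> polys_over A" "poly p x \<in> P" "\<exists>i. coeff p i \<notin> P" for p
    proof -
      from truncate_mod_prime[OF A P p(1,3), of x] obtain p' where
        p': "p' \<in> polys_over A" "lead_coeff p' \<notin> P" "degree p' \<le> degree p" "poly p x - poly p' x \<in> P" by blast
      have "poly p' x \<in> P" using PD(8)[OF p(2) p'(4)] by simp
      then show ?thesis using p' by blast
    qed
    then obtain p0 where "?rel p0" using True by blast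
    define p where "p = (ARG_MIN degree p. ?rel p)"
    have p: "?rel p" unfolding p_def using \<open>?rel p0\<close> by (rule arg_min_natI)
    have least: "degree p \<le> degree p'" if "?rel p'" for p'
      unfolding p_def using that by (rule arg_min_nat_le)
    define n where "n = degree p"
    define a where "a = lead_coeff p"
    have a: "a \<in> A" "a \<notin> P" unfolding a_def using p polys_overD by blast+
    have small: "coeff r i \<in> P" if "r \<in> polys_over A" "poly r x \<in> P" "degree r < n" for r i
      using trunc[OF that(1,2)] least that(3) unfolding n_def by (meson leD le_less_trans)
    have n: "n > 0"
    proof (rule ccontr)
      assume "\<not> n > 0"
      then obtain c where "p = [:c:]" unfolding n_def using degree_eq_zeroE by auto
      then show False using p by auto
    qed
    \<comment> \<open>Euclid's algorithm for \<open>p\<close> and \<open>u\<close>: the minimality of the degree of \<open>p\<close> keeps the value of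
      each remainder at \<open>x\<close> outside \<open>P\<close>, so the algorithm ends in a constant outside \<open>P\<close>.\<close>
    have inv: "\<exists>c\<in>A. c \<notin> P \<and> (\<exists>u'\<in>polys_over A. poly u x * poly u' x - c \<in> P)"
      if "u \<in> polys_over A" "poly u x \<notin> P" "degree u < m" "m \<le> n" for u m
      using that
    proof (induction m arbitrary: u)
      case (Suc m)
      have "\<exists>i. coeff u i \<notin> P" using Suc.prems poly_in_prime_set[OF P] by blast
      from truncate_mod_prime[OF A P Suc.prems(1) this, of x] obtain v where
        v: "v \<in> polys_over A" "lead_coeff v \<notin> P" "degree v \<le> degree u" "poly u x - poly v x \<in> P" by blast
      have vP: "poly v x \<notin> P" using PD(3)[OF v(4)] Suc.prems(2) by fastforce
      have "\<exists>c\<in>A. c \<notin> P \<and> (\<exists>u'\<in>polys_over A. poly v x * poly u' x - c \<in> P)"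
      proof (cases "degree v = 0")
        case True
        then obtain c where c: "v = [:c:]" using degree_eq_zeroE by auto
        have "c \<in> A" using polys_overD[OF v(1), of 0] c by simp
        then show ?thesis using v(2) c RP PD(1) by (intro bexI[of _ c] conjI bexI[of _ 1]) auto
      next
        case False
        let ?b = "lead_coeff v"
        have b: "?b \<in> A" using v(1) by (rule polys_overD)
        obtain k s r where ksr: "s \<in> polys_over A" "r \<in> polys_over A"
          "smult (?b ^ k) p = s * v + r" "degree r < degree v" "s = 0 \<or> degree s < n"
        proof -
          have "degree p < degree v + n" using False by (simp add: n_def)
          from pseudo_division_over[OF A v(1) refl _ conjunct1[OF p] this] False
          show thesis using that by blast
        qed
        have "degree r < n" using ksr(4) v(3) Suc.prems by simp
        have rP: "poly r x \<notin> P"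
        proof
          \<comment> \<open>Then the coefficients of \<open>s\<close> and \<open>r\<close> lie in \<open>P\<close> by minimality, hence also the leading
            coefficient of \<open>p\<close> up to a power of \<open>?b\<close>.\<close>
          assume rP: "poly r x \<in> P"
          have "poly (smult (?b ^ k) p) x \<in> P" using p PD by simp
          then have "poly s x * poly v x + poly r x \<in> P" unfolding ksr(3) by simp
          then have "poly s x * poly v x \<in> P" using PD(8)[OF _ rP] by fastforce
          then have "poly s x \<in> P" using vP PD by blast
          then have cs: "coeff s i \<in> P" for i using small[OF ksr(1)] ksr(5) PD(1) by (cases "s = 0") auto
          have "coeff (s * v + r) n \<in> P"
            unfolding coeff_add coeff_mult
            by (intro PD(3) prime_set_sum[OF P] PD(5) cs small[OF ksr(2) rP \<open>degree r < n\<close>])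
          then have "?b ^ k * a \<in> P" unfolding ksr(3)[symmetric] by (simp add: a_def n_def)
          then show False using a(2) prime_set_power[OF P v(2)] PD(6) by blast
        qed
        have "degree r < m" using ksr(4) v(3) Suc.prems by simp
        from Suc.IH[OF ksr(2) rP this] Suc.prems obtain c r' where
          c: "c \<in> A" "c \<notin> P" "r' \<in> polys_over A" "poly r x * poly r' x - c \<in> P" by auto
        have "poly v x * poly (- (s * r')) x - c =
          (poly r x * poly r' x - c) - poly r' x * poly (s * v + r) x"
          by (simp add: algebra_simps)
        also have "\<dots> \<in> P"
          unfolding ksr(3)[symmetric] using c p PD by simp
        finally show ?thesis using c RP(4,5) ksr(1) by blast
      qed
      then obtain c u' where c: "c \<in> A" "c \<notin> P" "u' \<in> polys_over A" "poly v x * poly u' x - c \<in> P" by blast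
      have "poly u x * poly u' x - c = (poly u x - poly v x) * poly u' x + (poly v x * poly u' x - c)"
        by (simp add: algebra_simps)
      also have "\<dots> \<in> P" using c v PD by simp
      finally show ?case using c by blast
    qed simp
    obtain k s r where ksr: "s \<in> polys_over A" "r \<in> polys_over A" "smult (a ^ k) q = s * p + r" "degree r < n"
    proof -
      have "degree q < n + Suc (degree q)" by simp
      from pseudo_division_over[OF A conjunct1[OF p] n_def[symmetric] n q this]
      show thesis using that unfolding a_def by blast
    qed
    have "poly (smult (a ^ k) q) x \<notin> P" using prime_set_power[OF P a(2)] f fq PD by simp
    then have "poly r x \<notin> P" unfolding ksr(3) using PD(3)[of "poly s x * poly p x"] PD(4) p by auto
    from inv[OF ksr(2) this ksr(4) order.refl] obtain c0 r' where
      c0: "c0 \<in> A" "c0 \<notin> P" "r' \<in> polys_over A" "poly r x * poly r' x - c0 \<in> P" by blast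
    have "poly (smult (a ^ k) q) x * poly r' x - c0 = (poly r x * poly r' x - c0) + poly s x * poly r' x * poly p x"
      unfolding ksr(3) by (simp add: algebra_simps)
    also have "\<dots> \<in> P" using c0 p PD by simp
    finally have q'P: "poly q x * poly (smult (a ^ k) r') x - c0 \<in> P" by (simp add: mult_ac)
    let ?q' = "smult (a ^ k) r'"
    have q': "?q' \<in> polys_over A" by (intro polys_over_smult A subring_set_power a c0)
    show ?thesis
    proof (intro bexI[of _ "a * c0"] conjI allI impI)
      show "a * c0 \<in> A" "a * c0 \<notin> P" using a c0 R PD by auto
      fix \<phi> :: "'r \<Rightarrow> 'k" assume h: "hom_on A P \<phi>" and nz: "\<phi> (a * c0) \<noteq> 0"
      note H = hom_onD[OF h] and hom = map_poly_hom_on[OF A P h]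
      have nz: "\<phi> a \<noteq> 0" "\<phi> c0 \<noteq> 0" using nz a c0 H by auto
      have pow: "\<phi> (a ^ k) = \<phi> a ^ k" for k by (induction k) (auto simp: H a subring_set_power[OF A])
      have "coeff (map_poly \<phi> p) n \<noteq> 0" using nz by (simp add: coeff_map_poly zero[OF h] a_def n_def)
      then have "degree (map_poly \<phi> p) > 0" using n le_degree by fastforce
      then obtain \<xi> where \<xi>: "poly (map_poly \<phi> p) \<xi> = 0" using alg_closed_imp_poly_has_root by blast
      have kill: "poly (map_poly \<phi> u) \<xi> = 0" if u: "u \<in> polys_over A" "poly u x \<in> P" for u
      proof -
        obtain k s r where ksr: "s \<in> polys_over A" "r \<in> polys_over A" "smult (a ^ k) u = s * p + r" "degree r < n"
        proof -
          have "degree u < n + Suc (degree u)" by simp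
          from pseudo_division_over[OF A conjunct1[OF p] n_def[symmetric] n u(1) this]
          show thesis using that unfolding a_def by blast
        qed
        have "poly r x = a ^ k * poly u x - poly s x * poly p x"
          using arg_cong[OF ksr(3), of "\<lambda>u. poly u x"] by simp
        then have "poly r x \<in> P" using u p PD by simp
        then have "\<phi> (coeff r i) = 0" for i
          using small[OF ksr(2) _ ksr(4)] H(4) polys_overD[OF ksr(2)] by blast
        then have "map_poly \<phi> r = 0" by (intro poly_eqI) (simp add: coeff_map_poly zero[OF h])
        moreover have "map_poly \<phi> ([:a ^ k:] * u) = map_poly \<phi> [:a ^ k:] * map_poly \<phi> u"
          by (intro hom u polys_over_const A subring_set_power a)
        moreover have "map_poly \<phi> [:a ^ k:] = [:\<phi> a ^ k:]" by (simp add: map_poly_pCons zero[OF h] pow)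
        moreover have "map_poly \<phi> (s * p + r) = map_poly \<phi> s * map_poly \<phi> p + map_poly \<phi> r"
          using hom(1)[of "s * p" r] hom(2)[of s p] ksr(1,2) p RP(4) by simp
        ultimately have "[:\<phi> a ^ k:] * map_poly \<phi> u = map_poly \<phi> s * map_poly \<phi> p" using ksr(3) by simp
        from arg_cong[OF this, of "\<lambda>u. poly u \<xi>"] show ?thesis using \<xi> nz by simp
      qed
      from extend_hom_by_value[OF A P h kill] obtain \<psi> where
        \<psi>: "hom_on (adjoin A x) P \<psi>" "\<And>a. a \<in> A \<Longrightarrow> \<psi> a = \<phi> a" by metis
      have "\<psi> f \<noteq> 0"
      proof
        assume 0: "\<psi> f = 0"
        have m: "poly q x \<in> adjoin A x" "poly ?q' x \<in> adjoin A x" "c0 \<in> adjoin A x"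
          using imageI[OF q, of "\<lambda>p. poly p x"] imageI[OF q', of "\<lambda>p. poly p x"] adjoin_base[OF A c0(1)]
          unfolding adjoin_def by blast+
        note S = subring_setD[OF subring_adjoin[OF A, of x]]
        have "\<psi> (poly q x * poly ?q' x - c0) = 0"
          by (rule hom_onD(4)[OF \<psi>(1) S(6)[OF S(4)[OF m(1,2)] m(3)] q'P])
        moreover have "\<psi> (poly q x * poly ?q' x) = \<psi> (poly q x * poly ?q' x - c0) + \<psi> c0"
          using hom_onD(2)[OF \<psi>(1) S(6)[OF S(4)[OF m(1,2)] m(3)] m(3)] by simp
        moreover have "\<psi> (poly q x * poly ?q' x) = 0"
          using hom_onD(3)[OF \<psi>(1) m(1,2)] 0 fq by simp
        ultimately show False using nz \<psi>(2)[OF c0(1)] by simp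
      qed
      with \<psi> show "\<exists>\<psi>. hom_on (adjoin A x) P \<psi> \<and> (\<forall>a\<in>A. \<psi> a = \<phi> a) \<and> \<psi> f \<noteq> 0" by blast
    qed
  qed
qed

text \<open>The element of \<open>A[xs]\<close> that has to survive is replaced by one of the ring with one generator less,
  until it lies in \<open>A\<close>.\<close>

lemma extend_hom_list:
  fixes A :: "'r::comm_ring_1 set"
  assumes A: "subring_set A" and P: "prime_set P" and f: "f \<in> adjoin_list A xs" "f \<notin> P"
  shows "\<exists>c\<in>A. c \<notin> P \<and> (\<forall>\<phi> :: 'r \<Rightarrow> 'k::{alg_closed_field, field_char_0}. hom_on A P \<phi> \<longrightarrow> \<phi> c \<noteq> 0 \<longrightarrow>
    (\<exists>\<psi>. hom_on (adjoin_list A xs) P \<psi> \<and> (\<forall>a\<in>A. \<psi> a = \<phi> a) \<and> \<psi> f \<noteq> 0))"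
  using f
proof (induction xs arbitrary: f)
  case Nil
  then show ?case by auto
next
  case (Cons x xs)
  let ?B = "adjoin_list A xs"
  obtain b where b: "b \<in> ?B" "b \<notin> P" and ext_b: "\<forall>\<phi> :: 'r \<Rightarrow> 'k. hom_on ?B P \<phi> \<longrightarrow> \<phi> b \<noteq> 0 \<longrightarrow>
      (\<exists>\<psi>. hom_on (adjoin ?B x) P \<psi> \<and> (\<forall>a\<in>?B. \<psi> a = \<phi> a) \<and> \<psi> f \<noteq> 0)"
    using extend_hom[OF subring_adjoin_list[OF A] P Cons.prems[simplified], where ?'k = 'k]
    by (elim bexE conjE) (rule that)
  obtain c where c: "c \<in> A" "c \<notin> P" and ext_c: "\<forall>\<phi> :: 'r \<Rightarrow> 'k. hom_on A P \<phi> \<longrightarrow> \<phi> c \<noteq> 0 \<longrightarrow>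
      (\<exists>\<psi>. hom_on ?B P \<psi> \<and> (\<forall>a\<in>A. \<psi> a = \<phi> a) \<and> \<psi> b \<noteq> 0)"
    using Cons.IH[OF b] by (elim bexE conjE) (rule that)
  have "\<exists>\<psi>. hom_on (adjoin ?B x) P \<psi> \<and> (\<forall>a\<in>A. \<psi> a = \<phi> a) \<and> \<psi> f \<noteq> 0"
    if hc: "hom_on A P \<phi>" "\<phi> c \<noteq> 0" for \<phi> :: "'r \<Rightarrow> 'k"
  proof -
    obtain \<theta> where \<theta>: "hom_on ?B P \<theta>" "\<forall>a\<in>A. \<theta> a = \<phi> a" "\<theta> b \<noteq> 0" using ext_c hc by blast
    obtain \<psi> where \<psi>: "hom_on (adjoin ?B x) P \<psi>" "\<forall>a\<in>?B. \<psi> a = \<theta> a" "\<psi> f \<noteq> 0"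
      using ext_b \<theta>(1,3) by blast
    have "\<forall>a\<in>A. \<psi> a = \<phi> a" using \<psi>(2) \<theta>(2) adjoin_list_base[OF A, of _ xs] by simp
    with \<psi> show ?thesis by blast
  qed
  with c show ?case by auto
qed


section \<open>Polynomials in several variables\<close>

lemma mp_eval_Const_Var:
  fixes p :: "('x, 'k::comm_ring_1) mpoly"
  shows "mp_eval Const Var p = p"
proof -
  have pow: "(Var v :: ('x, 'k) mpoly) ^ n = Poly_Mapping.single (Poly_Mapping.single v n) 1" for v n
    by (induction n) (auto simp: Var_def mult_single simp flip: single_add)
  have prod: "(\<Prod>v\<in>V. Poly_Mapping.single (f v) (1::'k)) = Poly_Mapping.single (\<Sum>v\<in>V. f v) 1"
    for V :: "'x set" and f :: "'x \<Rightarrow> 'x \<Rightarrow>\<^sub>0 nat"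
    by (induction V rule: infinite_finite_induct) (auto simp: mult_single)
  have "mp_eval Const Var p = (\<Sum>m\<in>Poly_Mapping.keys p. Const (Poly_Mapping.lookup p m) * Poly_Mapping.single m 1)"
    unfolding mp_eval_def by (simp add: pow prod flip: mpoly_sum_single)
  also have "\<dots> = p"
    by (simp add: Const_def mult_single flip: mpoly_sum_single)
  finally show ?thesis .
qed

text \<open>Properties of ring homomorphisms on polynomials need to be checked only on constants and variables.\<close>

lemma mpoly_induct [case_names Const Var add mult]:
  fixes p :: "('x, 'k::comm_ring_1) mpoly"
  assumes "\<And>c. P (Const c)" "\<And>v. P (Var v)"
    and add: "\<And>p q. P p \<Longrightarrow> P q \<Longrightarrow> P (p + q)" and mult: "\<And>p q. P p \<Longrightarrow> P q \<Longrightarrow> P (p * q)"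
  shows "P p"
proof -
  have 0: "P 0" and 1: "P 1" using assms(1)[of 0] assms(1)[of 1] by (simp_all add: Const_simps)
  have sum: "P (sum f I)" if "\<And>i. P (f i)" for f :: "('x \<Rightarrow>\<^sub>0 nat) \<Rightarrow> ('x, 'k) mpoly" and I
    by (induction I rule: infinite_finite_induct) (auto simp: 0 that add)
  have pow: "P (q ^ n)" if "P q" for q n
    by (induction n) (auto simp: 1 that mult)
  have prod: "P (prod f I)" if "\<And>i. P (f i)" for f :: "'x \<Rightarrow> ('x, 'k) mpoly" and I
    by (induction I rule: infinite_finite_induct) (auto simp: 1 that mult)
  have "P (mp_eval Const Var p)"
    unfolding mp_eval_def by (intro sum mult prod pow assms)
  then show ?thesis by (simp add: mp_eval_Const_Var)
qed

abbreviation subst :: "('x \<Rightarrow> ('y, 'k) mpoly) \<Rightarrow> ('x, 'k::comm_ring_1) mpoly \<Rightarrow> ('y, 'k) mpoly"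
  where "subst \<sigma> \<equiv> mp_eval Const \<sigma>"

lemma subst_simps [simp]:
  "subst \<sigma> (p + q) = subst \<sigma> p + subst \<sigma> q" "subst \<sigma> (p * q) = subst \<sigma> p * subst \<sigma> q"
  "subst \<sigma> (Const c) = Const c" "subst \<sigma> (Var v) = \<sigma> v"
  "subst \<sigma> 0 = 0" "subst \<sigma> 1 = 1" "subst \<sigma> (- p) = - subst \<sigma> p" "subst \<sigma> (p - q) = subst \<sigma> p - subst \<sigma> q"
  "subst \<sigma> (sum f I) = (\<Sum>i\<in>I. subst \<sigma> (f i))"
proof -
  show add: "subst \<sigma> (p + q) = subst \<sigma> p + subst \<sigma> q" for p q
    by (rule mp_eval_add) (simp_all add: Const_simps)
  show "subst \<sigma> (p * q) = subst \<sigma> p * subst \<sigma> q" by (rule mp_eval_mult) (simp_all add: Const_simps)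
  show C: "subst \<sigma> (Const c) = Const c" for c by (rule mp_eval_Const) (simp_all add: Const_simps)
  show "subst \<sigma> (Var v) = \<sigma> v" by (rule mp_eval_Var) (simp_all add: Const_simps)
  show "subst \<sigma> (sum f I) = (\<Sum>i\<in>I. subst \<sigma> (f i))" by (rule mp_eval_sum) (simp_all add: Const_simps)
  show 0: "subst \<sigma> 0 = 0" by (rule mp_eval_0)
  show "subst \<sigma> 1 = 1" using C[of 1] by (simp add: Const_simps)
  show neg: "subst \<sigma> (- p) = - subst \<sigma> p" for p
    using add[of p "- p"] by (simp add: 0 eq_neg_iff_add_eq_0 add.commute)
  show "subst \<sigma> (p - q) = subst \<sigma> p - subst \<sigma> q" using add[of p "- q"] by (simp add: neg)
qed

lemma peval_simps [simp]:
  fixes p q :: "('x, 'k::comm_ring_1) mpoly"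
  shows "peval (p + q) x = peval p x + peval q x" "peval (p * q) x = peval p x * peval q x"
  "peval (Const c) x = c" "peval (Var v) x = x v" "peval (0 :: ('x, 'k) mpoly) x = 0"
  "peval (1 :: ('x, 'k) mpoly) x = 1"
  "peval (p - q) x = peval p x - peval q x" "peval (p ^ n) x = peval p x ^ n"
proof -
  show add: "peval (p + q) x = peval p x + peval q x" for p q :: "('x, 'k) mpoly"
    by (rule mp_eval_add) simp_all
  show mult: "peval (p * q) x = peval p x * peval q x" for p q :: "('x, 'k) mpoly"
    by (rule mp_eval_mult) simp_all
  show C: "peval (Const c) x = c" for c by (rule mp_eval_Const) simp
  show "peval (Var v) x = x v" by (rule mp_eval_Var) simp_all
  show "peval (0 :: ('x, 'k) mpoly) x = 0" by (rule mp_eval_0)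
  show 1: "peval (1 :: ('x, 'k) mpoly) x = 1" using C[of 1] by (simp add: Const_simps)
  show "peval (p - q) x = peval p x - peval q x" using add[of "p - q" q] by (simp add: algebra_simps)
  show "peval (p ^ n) x = peval p x ^ n" by (induction n) (simp_all add: 1 mult)
qed

lemma peval_subst: "peval (subst \<sigma> p) x = peval p (\<lambda>v. peval (\<sigma> v) x)"
  by (induction p rule: mpoly_induct) auto

lemma subst_subst: "subst \<sigma> (subst \<tau> p) = subst (\<lambda>v. subst \<sigma> (\<tau> v)) p"
  by (induction p rule: mpoly_induct) auto

lemma subring_range_Const: "subring_set (range (Const :: 'k::comm_ring_1 \<Rightarrow> ('x, 'k) mpoly))"
proof -
  have "- Const a = Const (- a)" for a :: 'k
    using subst_simps(7)[of _ "Const a"] by (simp add: Const_def single_uminus)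
  moreover have "0 = Const (0::'k)" "1 = Const (1::'k)" by (simp_all add: Const_simps)
  ultimately show ?thesis unfolding subring_set_def by (auto simp flip: Const_simps)
qed

lemma noetherian_range_Const: "noetherian (range (Const :: 'k::field \<Rightarrow> ('x, 'k) mpoly))"
  by (rule noetherian_field_image) (simp_all add: Const_simps)

lemma subst_in_subring:
  assumes "subring_set A" "\<And>c. Const c \<in> A" "\<And>v. \<sigma> v \<in> A"
  shows "subst \<sigma> p \<in> A"
  using assms by (induction p rule: mpoly_induct) (auto simp: subring_setD)

lemma lookup_Const_mult: "Poly_Mapping.lookup (Const c * p) m = c * Poly_Mapping.lookup p m"
  for p :: "('v, 'k::comm_ring_1) mpoly"
  unfolding Const_def mult_map_scale_conv_mult[symmetric] by (simp add: map.rep_eq when_def)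

lemma Const_inverse_mult: "c \<noteq> 0 \<Longrightarrow> Const (inverse c) * (Const c * p) = p"
  for c :: "'k::field" and p :: "('v, 'k) mpoly"
proof -
  assume "c \<noteq> 0"
  then have "Const (inverse c) * Const c = (1 :: ('v, 'k) mpoly)" by (simp flip: Const_simps)
  then show ?thesis by (simp flip: mult.assoc)
qed


section \<open>The Nullstellensatz\<close>

text \<open>An ideal that is maximal among the ideals containing \<open>D\<close> but no power of \<open>f\<close> is prime: if
  neither \<open>a\<close> nor \<open>b\<close> belongs to it, then each of them generates together with it an ideal that
  contains a power of \<open>f\<close>, and the product of the two powers shows that \<open>a * b\<close> does not belong to
  it either.\<close>

lemma maximal_avoiding_powers:
  fixes D :: "'r::comm_ring_1 set"
  assumes D: "0 \<in> D" "\<And>a b. a \<in> D \<Longrightarrow> b \<in> D \<Longrightarrow> a + b \<in> D" "\<And>r a. a \<in> D \<Longrightarrow> r * a \<in> D"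
    and f: "\<And>n. f ^ n \<notin> D"
  shows "\<exists>P. prime_set P \<and> D \<subseteq> P \<and> f \<notin> P"
proof -
  define ok where "ok = {P :: 'r set. (0 \<in> P \<and> (\<forall>a\<in>P. \<forall>b\<in>P. a + b \<in> P) \<and> (\<forall>r. \<forall>a\<in>P. r * a \<in> P)) \<and>
    D \<subseteq> P \<and> (\<forall>n. f ^ n \<notin> P)}"
  have "D \<in> ok" using assms by (auto simp: ok_def)
  have "\<exists>M\<in>ok. \<forall>X\<in>ok. M \<subseteq> X \<longrightarrow> X = M"
  proof (rule subset_Zorn_nonempty)
    show "ok \<noteq> {}" using \<open>D \<in> ok\<close> by blast
    fix C assume C: "C \<noteq> {}" "subset.chain ok C"
    then have C': "P \<in> ok" if "P \<in> C" for P using that by (auto simp: subset.chain_def)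
    have "a + b \<in> \<Union>C" if ab: "a \<in> \<Union>C" "b \<in> \<Union>C" for a b
    proof -
      obtain P Q where PQ: "a \<in> P" "P \<in> C" "b \<in> Q" "Q \<in> C" using ab by blast
      then have "P \<subseteq> Q \<or> Q \<subseteq> P" using C(2) by (auto simp: subset.chain_def)
      then have "\<exists>R\<in>C. a \<in> R \<and> b \<in> R" using PQ by blast
      then show ?thesis using C' unfolding ok_def by blast
    qed
    moreover have "r * a \<in> \<Union>C" if "a \<in> \<Union>C" for r a using that C' unfolding ok_def by blast
    moreover have "0 \<in> \<Union>C" "D \<subseteq> \<Union>C" "\<And>n. f ^ n \<notin> \<Union>C" using C(1) C' unfolding ok_def by blast+
    ultimately show "\<Union>C \<in> ok" unfolding ok_def by blast
  qed
  then obtain P where P: "P \<in> ok" and max: "\<And>X. X \<in> ok \<Longrightarrow> P \<subseteq> X \<Longrightarrow> X = P" by blast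
  have cl: "0 \<in> P" "\<And>a b. a \<in> P \<Longrightarrow> b \<in> P \<Longrightarrow> a + b \<in> P" "\<And>r a. a \<in> P \<Longrightarrow> r * a \<in> P"
    and P': "D \<subseteq> P" "\<And>n. f ^ n \<notin> P" using P unfolding ok_def by blast+
  have ex: "\<exists>n. \<exists>p\<in>P. \<exists>r. f ^ n = p + r * a" if a: "a \<notin> P" for a
  proof (rule ccontr)
    assume no: "\<not> ?thesis"
    define X where "X = {p + r * a | p r. p \<in> P}"
    have "p \<in> X" if "p \<in> P" for p
      unfolding X_def using that by (intro CollectI exI[of _ p] exI[of _ 0]) simp
    then have PX: "P \<subseteq> X" by blast
    have "X \<in> ok"
      unfolding ok_def
    proof (intro CollectI conjI ballI allI)
      show "0 \<in> X" using PX cl by blast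
      show "D \<subseteq> X" using PX P' by blast
      show "f ^ n \<notin> X" for n using no unfolding X_def by blast
    next
      fix u v assume "u \<in> X" "v \<in> X"
      then obtain p r q s where *: "u = p + r * a" "p \<in> P" "v = q + s * a" "q \<in> P" unfolding X_def by blast
      then have "u + v = (p + q) + (r + s) * a" by (simp add: algebra_simps)
      then show "u + v \<in> X" using cl * unfolding X_def by blast
    next
      fix t u assume "u \<in> X"
      then obtain p r where *: "u = p + r * a" "p \<in> P" unfolding X_def by blast
      then have "t * u = t * p + (t * r) * a" by (simp add: algebra_simps)
      then show "t * u \<in> X" using cl * unfolding X_def by blast
    qed
    from max[OF this PX] have "X = P" .
    moreover have "0 + 1 * a \<in> X" using cl(1) unfolding X_def by blast
    ultimately show False using a by simp
  qed
  have "a \<in> P \<or> b \<in> P" if ab: "a * b \<in> P" for a b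
  proof (rule ccontr)
    assume "\<not> ?thesis"
    then obtain m n p q r s where *: "f ^ m = p + r * a" "p \<in> P" "f ^ n = q + s * b" "q \<in> P"
      using ex[of a] ex[of b] by blast
    have "f ^ (m + n) = (q + s * b) * p + (r * a) * q + (r * s) * (a * b)"
      unfolding power_add * by (simp add: algebra_simps)
    then have "f ^ (m + n) \<in> P" using cl * ab by simp
    then show False using P' by blast
  qed
  moreover have "1 \<notin> P" "f \<notin> P" using P'(2)[of 0] P'(2)[of 1] by simp_all
  ultimately have "prime_set P" unfolding prime_set_def using cl by blast
  then show ?thesis using P' \<open>f \<notin> P\<close> by blast
qed

text \<open>If no power of \<open>f\<close> lies in \<open>D\<close>, there is a prime ideal containing \<open>D\<close> but not \<open>f\<close>. Modulo this
  ideal, the identity on constants extends to a homomorphism on all polynomials that does not kill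
  \<open>f\<close>. Such a homomorphism is the evaluation at a point, which is a zero of \<open>D\<close> but not of \<open>f\<close>.\<close>

theorem nullstellensatz:
  fixes D :: "('n::finite, 'k::{alg_closed_field, field_char_0}) mpoly set"
  assumes D: "0 \<in> D" "\<And>a b. a \<in> D \<Longrightarrow> b \<in> D \<Longrightarrow> a + b \<in> D" "\<And>r a. a \<in> D \<Longrightarrow> r * a \<in> D"
    and f: "\<And>x. (\<And>p. p \<in> D \<Longrightarrow> peval p x = 0) \<Longrightarrow> peval f x = 0"
  shows "\<exists>n. f ^ n \<in> D"
proof (rule ccontr)
  assume "\<not> ?thesis"
  then obtain P where P: "prime_set P" "D \<subseteq> P" "f \<notin> P" using maximal_avoiding_powers[OF D] by blast
  obtain vs :: "'n list" where vs: "set vs = UNIV" using finite_list[OF finite_UNIV] by blast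
  let ?K = "range (Const :: 'k \<Rightarrow> ('n, 'k) mpoly)"
  let ?A = "adjoin_list ?K (map Var vs)"
  note K = subring_range_Const[where ?'k = 'k and ?'x = 'n]
  note A = subring_adjoin_list[OF K]
  have C: "Const c \<in> ?A" for c by (rule adjoin_list_base[OF K]) simp
  have V: "Var v \<in> ?A" for v by (rule adjoin_list_elem[OF K]) (simp add: vs)
  have all: "p \<in> ?A" for p
    using subst_in_subring[where \<sigma> = Var and p = p, OF A C V] by (simp add: mp_eval_Const_Var)
  let ?\<phi> = "\<lambda>p :: ('n, 'k) mpoly. Poly_Mapping.lookup p 0"
  have \<phi>C: "?\<phi> (Const c) = c" for c by (simp add: Const_def)
  have ConstP: "c = 0" if "Const c \<in> P" for c
  proof (rule ccontr)
    assume "c \<noteq> 0"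
    then have "Const (inverse c) * Const c = (1 :: ('n, 'k) mpoly)" by (simp flip: Const_simps)
    with prime_setD(4)[OF P(1) that, of "Const (inverse c)"] prime_setD(2)[OF P(1)] show False by simp
  qed
  have "hom_on ?K P ?\<phi>"
    unfolding hom_on_def using ConstP
    by (auto simp: \<phi>C simp flip: Const_simps)
  moreover obtain c where "c \<in> ?K" "c \<notin> P" and ext: "\<forall>\<phi> :: _ \<Rightarrow> 'k. hom_on ?K P \<phi> \<longrightarrow> \<phi> c \<noteq> 0 \<longrightarrow>
    (\<exists>\<psi>. hom_on ?A P \<psi> \<and> (\<forall>a\<in>?K. \<psi> a = \<phi> a) \<and> \<psi> f \<noteq> 0)"
    using extend_hom_list[OF K P(1) all P(3)] by (elim bexE conjE) (rule that)
  moreover have "?\<phi> c \<noteq> 0" using \<open>c \<in> ?K\<close> \<open>c \<notin> P\<close> prime_setD(1)[OF P(1)] by (auto simp: \<phi>C Const_simps)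
  ultimately obtain \<psi> where \<psi>: "hom_on ?A P \<psi>" "\<forall>a\<in>?K. \<psi> a = ?\<phi> a" "\<psi> f \<noteq> 0" by blast
  have pe: "\<psi> p = peval p (\<lambda>v. \<psi> (Var v))" for p
    by (induction p rule: mpoly_induct) (use \<psi>(2) in \<open>auto simp: \<phi>C hom_onD[OF \<psi>(1)] all\<close>)
  have "peval f (\<lambda>v. \<psi> (Var v)) = 0"
    by (rule f) (use P(2) hom_onD(4)[OF \<psi>(1) all] in \<open>auto simp flip: pe\<close>)
  then show False using \<psi>(3) by (simp flip: pe)
qed


section \<open>Functions on affine varieties\<close>

lemma coord_ringI: "f \<in> extensional X \<Longrightarrow> (\<And>x. x \<in> X \<Longrightarrow> f x = peval p x) \<Longrightarrow> f \<in> coord_ring X"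
  unfolding coord_ring_def by (intro CollectI exI[of _ p]) (auto intro: extensionalityI)

lemma coord_ringD:
  assumes "f \<in> coord_ring X"
  shows "f \<in> extensional X" "\<exists>p. \<forall>x\<in>X. f x = peval p x"
  using assms unfolding coord_ring_def by auto

lemma coord_ring_closed:
  assumes "f \<in> coord_ring X" "g \<in> coord_ring X"
  shows "(\<lambda>x\<in>X. f x + g x) \<in> coord_ring X" "(\<lambda>x\<in>X. f x * g x) \<in> coord_ring X"
    "(\<lambda>x\<in>X. c * f x) \<in> coord_ring X" "(\<lambda>x\<in>X. f x ^ n) \<in> coord_ring X"
proof -
  obtain p q where [simp]: "\<And>x. x \<in> X \<Longrightarrow> f x = peval p x" "\<And>x. x \<in> X \<Longrightarrow> g x = peval q x"
    using assms[THEN coord_ringD(2)] by blast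
  show "(\<lambda>x\<in>X. f x + g x) \<in> coord_ring X" by (rule coord_ringI[of _ _ "p + q"]) simp_all
  show "(\<lambda>x\<in>X. f x * g x) \<in> coord_ring X" by (rule coord_ringI[of _ _ "p * q"]) simp_all
  show "(\<lambda>x\<in>X. c * f x) \<in> coord_ring X" by (rule coord_ringI[of _ _ "Const c * p"]) simp_all
  show "(\<lambda>x\<in>X. f x ^ n) \<in> coord_ring X" by (rule coord_ringI[of _ _ "p ^ n"]) simp_all
qed

text \<open>The zero sets of the two factors are closed and cover \<open>X\<close>, so one of them is \<open>X\<close>.\<close>

lemma irreducible_no_zero_divisors:
  assumes X: "irreducible_closed X" and fg: "f \<in> coord_ring X" "g \<in> coord_ring X"
    and 0: "\<And>x. x \<in> X \<Longrightarrow> f x * g x = 0"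
  shows "(\<forall>x\<in>X. f x = 0) \<or> (\<forall>x\<in>X. g x = 0)"
proof -
  obtain p q where pq: "\<And>x. x \<in> X \<Longrightarrow> f x = peval p x" "\<And>x. x \<in> X \<Longrightarrow> g x = peval q x"
    using fg[THEN coord_ringD(2)] by blast
  obtain S where S: "X = {x. \<forall>p\<in>S. peval p x = 0}"
    using conjunct1[OF X[unfolded irreducible_closed_def]] unfolding zariski_closed_def ..
  have irr: "X = A \<or> X = B" if "zariski_closed A" "zariski_closed B" "X = A \<union> B" for A B
    using X that unfolding irreducible_closed_def by simp
  have closed: "zariski_closed {x \<in> X. peval r x = 0}" for r
    unfolding zariski_closed_def by (rule exI[of _ "insert r S"]) (auto simp: S)
  have "X = {x \<in> X. peval p x = 0} \<union> {x \<in> X. peval q x = 0}" using 0 pq by auto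
  from irr[OF closed closed this] have "X = {x \<in> X. peval p x = 0} \<or> X = {x \<in> X. peval q x = 0}" .
  then show ?thesis using pq by auto
qed

text \<open>The denominators of \<open>f\<close> on the principal open set form an ideal that contains the ideal of \<open>X\<close>.
  By the definition of regular functions it has no zero in this set, so the Nullstellensatz
  provides a power of \<open>h\<close> in it.\<close>

lemma regular_on_principal_open:
  fixes X :: "('n::finite \<Rightarrow> 'k::{alg_closed_field, field_char_0}) set"
  assumes X: "zariski_closed X" and h: "h \<in> coord_ring X"
    and f: "f \<in> regular_functions {x \<in> X. h x \<noteq> 0}"
  shows "\<exists>s. \<exists>g\<in>coord_ring X. \<forall>x\<in>X. h x \<noteq> 0 \<longrightarrow> g x = h x ^ s * f x"
proof -
  obtain H where H: "\<And>x. x \<in> X \<Longrightarrow> h x = peval H x" using coord_ringD(2)[OF h] by blast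
  obtain S where S: "X = {x. \<forall>p\<in>S. peval p x = 0}" using X unfolding zariski_closed_def by blast
  define D where "D = {d. \<exists>g. \<forall>x\<in>X. h x \<noteq> 0 \<longrightarrow> peval g x = peval d x * f x}"
  have "\<exists>n. H ^ n \<in> D"
  proof (rule nullstellensatz)
    show "0 \<in> D" unfolding D_def by (intro CollectI exI[of _ 0]) simp
    show "a + b \<in> D" if ab: "a \<in> D" "b \<in> D" for a b
    proof -
      obtain g k where "\<forall>x\<in>X. h x \<noteq> 0 \<longrightarrow> peval g x = peval a x * f x"
        "\<forall>x\<in>X. h x \<noteq> 0 \<longrightarrow> peval k x = peval b x * f x" using ab unfolding D_def by blast
      then show ?thesis unfolding D_def by (intro CollectI exI[of _ "g + k"]) (simp add: distrib_right)
    qed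
    show "r * a \<in> D" if a: "a \<in> D" for r a
    proof -
      obtain g where "\<forall>x\<in>X. h x \<noteq> 0 \<longrightarrow> peval g x = peval a x * f x" using a unfolding D_def by blast
      then show ?thesis unfolding D_def by (intro CollectI exI[of _ "r * g"]) (simp add: mult.assoc)
    qed
    fix x assume x: "\<And>p. p \<in> D \<Longrightarrow> peval p x = 0"
    show "peval H x = 0"
    proof (rule ccontr)
      assume nz: "peval H x \<noteq> 0"
      have "S \<subseteq> D" unfolding D_def by (auto simp: S intro!: exI[of _ 0])
      then have xX: "x \<in> X" using x by (auto simp: S)
      then have "h x \<noteq> 0" using nz H by simp
      with f xX obtain Z p q where Z: "zariski_closed Z" "x \<notin> Z" and
        pq: "\<And>y. y \<in> X \<Longrightarrow> h y \<noteq> 0 \<Longrightarrow> y \<notin> Z \<Longrightarrow> peval q y \<noteq> 0 \<and> f y = peval p y / peval q y"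
        unfolding regular_functions_def by blast
      obtain T where T: "Z = {x. \<forall>p\<in>T. peval p x = 0}" using Z(1) unfolding zariski_closed_def by blast
      then obtain t where t: "t \<in> T" "peval t x \<noteq> 0" using Z(2) by blast
      \<comment> \<open>The factor \<open>t\<close> makes the local equation valid on \<open>Z\<close> too, where both sides vanish.\<close>
      have "peval (t * p) y = peval (t * q) y * f y" if "y \<in> X" "h y \<noteq> 0" for y
        using pq[OF that] t(1) T by (cases "y \<in> Z") auto
      then have "t * q \<in> D" unfolding D_def by blast
      from x[OF this] show False using t(2) pq[OF xX \<open>h x \<noteq> 0\<close> Z(2)] by simp
    qed
  qed
  then obtain n g where g: "\<forall>x\<in>X. h x \<noteq> 0 \<longrightarrow> peval g x = peval (H ^ n) x * f x" unfolding D_def by blast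
  have "restrict (peval g) X \<in> coord_ring X" unfolding coord_ring_def by blast
  then show ?thesis using g H by (intro exI[of _ n] bexI[of _ "restrict (peval g) X"]) simp_all
qed


section \<open>The semi-invariant functionals of an Omega-process\<close>

context linear_algebraic_monoid
begin

lemma mul_closed: "x \<in> M \<Longrightarrow> y \<in> M \<Longrightarrow> mul x y \<in> M"
proof -
  assume "x \<in> M" "y \<in> M"
  then have "case_sum x y \<in> variety_prod M M" by (simp add: variety_prod_def comp_def)
  then show ?thesis using mul_morphism unfolding variety_morphism_def by (force simp: comp_def)
qed

lemma rtrans_coord:
  assumes f: "f \<in> coord_ring M" and m: "m \<in> M"
  shows "rtrans f m \<in> coord_ring M"
proof -
  obtain p where p: "\<And>x. x \<in> M \<Longrightarrow> f x = peval p x" using coord_ringD(2)[OF f] by blast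
  have "\<exists>q. \<forall>z\<in>variety_prod M M. mul (z \<circ> Inl) (z \<circ> Inr) i = peval q z" for i
    using mul_morphism unfolding variety_morphism_def by blast
  then obtain q where q: "\<And>i z. z \<in> variety_prod M M \<Longrightarrow> mul (z \<circ> Inl) (z \<circ> Inr) i = peval (q i) z" by metis
  let ?r = "subst (\<lambda>i. subst (case_sum (\<lambda>j. Const (m j)) Var) (q i)) p"
  have "f (mul m x) = peval ?r x" if x: "x \<in> M" for x
  proof -
    have "case_sum m x \<in> variety_prod M M" using m x by (simp add: variety_prod_def comp_def)
    from q[OF this] have "mul m x i = peval (q i) (case_sum m x)" for i by (simp add: comp_def)
    moreover have "(\<lambda>v. peval (case_sum (\<lambda>j. Const (m j)) Var v) x) = case_sum m x"
      by (auto split: sum.split)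
    ultimately have "mul m x = (\<lambda>i. peval (subst (case_sum (\<lambda>j. Const (m j)) Var) (q i)) x)"
      by (intro ext) (simp add: peval_subst)
    then show ?thesis using p[OF mul_closed[OF m x]] by (simp add: peval_subst)
  qed
  then show ?thesis by (intro coord_ringI[of _ _ ?r]) (auto simp: rtrans_def)
qed

end

locale omega_monoid = linear_algebraic_monoid M mul e
  for M :: "('n::finite \<Rightarrow> 'k::{alg_closed_field, field_char_0}) set" and mul e +
  fixes \<chi> :: "('n \<Rightarrow> 'k) \<Rightarrow> 'k" and \<Omega> :: "(('n \<Rightarrow> 'k) \<Rightarrow> 'k) \<Rightarrow> (('n \<Rightarrow> 'k) \<Rightarrow> 'k)" and z :: "'n \<Rightarrow> 'k"
  assumes z: "zero_element z"
    and units: "G = {m \<in> M. \<chi> m \<noteq> 0}"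
    and omega: "proper_omega_process \<chi> \<Omega>"
begin

lemma char: "\<chi> \<in> coord_ring M" "x \<in> M \<Longrightarrow> y \<in> M \<Longrightarrow> \<chi> (mul x y) = \<chi> x * \<chi> y" "\<chi> e = 1"
  using omega unfolding proper_omega_process_def omega_process_def nontrivial_character_def
    polynomial_character_def by blast+

lemma char_power: "(\<lambda>x\<in>M. \<chi> x ^ s) \<in> coord_ring M"
  using coord_ring_closed(4)[OF char(1) char(1)] .

lemma mul_units: "g \<in> G \<Longrightarrow> h \<in> G \<Longrightarrow> mul g h \<in> G"
  by (simp add: units mul_closed char)

lemma e_unit: "e \<in> G" by (simp add: units char e_in)

text \<open>The unit group is dense: the difference of \<open>f\<close> and \<open>g\<close> is annihilated by the character, which is a
  nonzero element of a ring without zero divisors.\<close>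

lemma eq_on_units:
  assumes fg: "f \<in> coord_ring M" "g \<in> coord_ring M" and eq: "\<And>x. x \<in> G \<Longrightarrow> f x = g x"
    and x: "x \<in> M"
  shows "f x = g x"
proof -
  let ?d = "\<lambda>x\<in>M. f x + (\<lambda>x\<in>M. - 1 * g x) x"
  have d: "?d \<in> coord_ring M" by (intro coord_ring_closed(1) coord_ring_closed(3)[OF fg(2) fg(2)] fg)
  have "\<chi> x * ?d x = 0" if "x \<in> M" for x using that eq[of x] by (auto simp: units)
  from irreducible_no_zero_divisors[OF irreducible char(1) d this] e_in
  have "\<forall>x\<in>M. ?d x = 0" by (auto simp: char)
  then show ?thesis using x by simp
qed

lemma omega_linear:
  "f \<in> coord_ring M \<Longrightarrow> \<Omega> f \<in> coord_ring M"
  "f \<in> coord_ring M \<Longrightarrow> g \<in> coord_ring M \<Longrightarrow> \<Omega> (\<lambda>x\<in>M. f x + g x) = (\<lambda>x\<in>M. \<Omega> f x + \<Omega> g x)"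
  "f \<in> coord_ring M \<Longrightarrow> \<Omega> (\<lambda>x\<in>M. c * f x) = (\<lambda>x\<in>M. c * \<Omega> f x)"
  using omega unfolding proper_omega_process_def omega_process_def linear_operator_def by blast+

lemma omega_rtrans:
  "f \<in> coord_ring M \<Longrightarrow> m \<in> M \<Longrightarrow> \<Omega> (rtrans f m) = (\<lambda>x\<in>M. \<chi> m * rtrans (\<Omega> f) m x)"
  using omega unfolding proper_omega_process_def omega_process_def by blast

lemma omega_pow_linear:
  assumes f: "f \<in> coord_ring M"
  shows "(\<Omega> ^^ s) f \<in> coord_ring M"
    and "g \<in> coord_ring M \<Longrightarrow> (\<Omega> ^^ s) (\<lambda>x\<in>M. f x + g x) = (\<lambda>x\<in>M. (\<Omega> ^^ s) f x + (\<Omega> ^^ s) g x)"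
    and "(\<Omega> ^^ s) (\<lambda>x\<in>M. c * f x) = (\<lambda>x\<in>M. c * (\<Omega> ^^ s) f x)"
proof -
  have coord: "(\<Omega> ^^ s) f \<in> coord_ring M" if "f \<in> coord_ring M" for f s
    by (induction s) (auto simp: that omega_linear)
  show "(\<Omega> ^^ s) f \<in> coord_ring M" by (rule coord[OF f])
  show "(\<Omega> ^^ s) (\<lambda>x\<in>M. f x + g x) = (\<lambda>x\<in>M. (\<Omega> ^^ s) f x + (\<Omega> ^^ s) g x)" if "g \<in> coord_ring M"
  proof (induction s)
    case (Suc s)
    show ?case
      unfolding funpow.simps comp_apply Suc.IH by (rule omega_linear(2)[OF coord[OF f] coord[OF that]])
  qed simp
  show "(\<Omega> ^^ s) (\<lambda>x\<in>M. c * f x) = (\<lambda>x\<in>M. c * (\<Omega> ^^ s) f x)"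
  proof (induction s)
    case (Suc s)
    show ?case unfolding funpow.simps comp_apply Suc.IH by (rule omega_linear(3)[OF coord[OF f]])
  qed simp
qed

lemma omega_pow_rtrans:
  assumes f: "f \<in> coord_ring M" and m: "m \<in> M"
  shows "(\<Omega> ^^ s) (rtrans f m) = (\<lambda>x\<in>M. \<chi> m ^ s * rtrans ((\<Omega> ^^ s) f) m x)"
proof (induction s)
  case 0
  then show ?case by (auto simp: rtrans_def)
next
  case (Suc s)
  note c = omega_pow_linear(1)[OF f, of s]
  have "(\<Omega> ^^ Suc s) (rtrans f m) = (\<lambda>x\<in>M. \<chi> m ^ s * \<Omega> (rtrans ((\<Omega> ^^ s) f) m) x)"
    unfolding funpow.simps comp_apply Suc.IH by (rule omega_linear(3)[OF rtrans_coord[OF c m]])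
  also have "\<dots> = (\<lambda>x\<in>M. \<chi> m ^ Suc s * rtrans (\<Omega> ((\<Omega> ^^ s) f)) m x)"
    unfolding omega_rtrans[OF c m] by (rule restrict_ext) simp
  finally show ?case by simp
qed

text \<open>Translation by \<open>m\<close> multiplies the power of the character by a scalar. Comparing values at the neutral
  element determines the image under the process at every unit \<open>m\<close>, and the units are dense.\<close>

lemma omega_char_power:
  "\<Omega> (\<lambda>x\<in>M. \<chi> x ^ Suc s) = (\<lambda>x\<in>M. \<Omega> (\<lambda>x\<in>M. \<chi> x ^ Suc s) e * (\<lambda>x\<in>M. \<chi> x ^ s) x)"
proof -
  let ?p = "\<lambda>x\<in>M. \<chi> x ^ Suc s"
  let ?r = "\<lambda>x\<in>M. \<Omega> ?p e * (\<lambda>x\<in>M. \<chi> x ^ s) x"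
  have r: "?r \<in> coord_ring M" by (rule coord_ring_closed(3)[OF char_power char_power])
  have l: "\<Omega> ?p \<in> coord_ring M" by (rule omega_linear(1)[OF char_power])
  have "\<Omega> ?p m = ?r m" if m: "m \<in> G" for m
  proof -
    have mM: "m \<in> M" and nz: "\<chi> m \<noteq> 0" using m by (auto simp: units)
    have "rtrans ?p m = (\<lambda>x\<in>M. \<chi> m ^ Suc s * ?p x)"
      using mM by (auto simp: rtrans_def char mul_closed power_mult_distrib mult_ac)
    with omega_rtrans[OF char_power mM, of "Suc s"]
    have "(\<lambda>x\<in>M. \<chi> m * rtrans (\<Omega> ?p) m x) = (\<lambda>x\<in>M. \<chi> m ^ Suc s * \<Omega> ?p x)"
      by (simp only: omega_linear(3)[OF char_power])
    from fun_cong[OF this, of e] have "\<chi> m * \<Omega> ?p m = \<chi> m * (\<chi> m ^ s * \<Omega> ?p e)"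
      using e_in mM by (simp add: rtrans_def e_right)
    then show ?thesis using nz mM by simp
  qed
  from eq_on_units[OF l r this] show ?thesis
    using coord_ringD(1)[OF l] by (intro extensionalityI[of _ M]) auto
qed

text \<open>The zero element absorbs translations, so evaluating there the \<open>s\<close>-th power of the process
  gives a functional on which a translation by \<open>m\<close> acts by the scalar \<open>\<chi> m ^ s\<close>. After division by
  the \<open>s\<close>-th power of the character it is an invariant functional, like a Haar integral.\<close>

definition eps :: "nat \<Rightarrow> (('n \<Rightarrow> 'k) \<Rightarrow> 'k) \<Rightarrow> 'k"
  where "eps s f = (\<Omega> ^^ s) f z"

lemma zM: "z \<in> M" using z by (simp add: zero_element_def)

lemma eps_linear:
  "f \<in> coord_ring M \<Longrightarrow> g \<in> coord_ring M \<Longrightarrow> eps s (\<lambda>x\<in>M. f x + g x) = eps s f + eps s g"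
  "f \<in> coord_ring M \<Longrightarrow> eps s (\<lambda>x\<in>M. c * f x) = c * eps s f"
  by (simp_all add: eps_def omega_pow_linear zM)

lemma eps_rtrans:
  "f \<in> coord_ring M \<Longrightarrow> m \<in> M \<Longrightarrow> eps s (rtrans f m) = \<chi> m ^ s * eps s f"
  unfolding eps_def omega_pow_rtrans using z zM by (simp add: rtrans_def zero_element_def)

text \<open>Each application of the process to a power of the character lowers the exponent by one and contributes
  a factor that is nonzero because the process is proper.\<close>

lemma eps_char_power: "eps s (\<lambda>x\<in>M. \<chi> x ^ s) \<noteq> 0"
proof (induction s)
  case 0
  then show ?case by (simp add: eps_def zM)
next
  case (Suc s)
  have "eps (Suc s) (\<lambda>x\<in>M. \<chi> x ^ Suc s) = (\<Omega> ^^ s) (\<Omega> (\<lambda>x\<in>M. \<chi> x ^ Suc s)) z"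
    by (simp only: eps_def funpow_Suc_right comp_def)
  also have "\<dots> = \<Omega> (\<lambda>x\<in>M. \<chi> x ^ Suc s) e * eps s (\<lambda>x\<in>M. \<chi> x ^ s)"
    unfolding eps_def by (subst omega_char_power) (simp only: omega_pow_linear(3)[OF char_power] zM restrict_apply' if_True)
  also have "\<dots> \<noteq> 0"
  proof (rule no_zero_divisors[OF _ Suc.IH])
    have "\<forall>s\<ge>1. \<Omega> (\<lambda>x\<in>M. \<chi> x ^ s) e \<noteq> 0" using omega unfolding proper_omega_process_def by (rule conjunct2)
    then show "\<Omega> (\<lambda>x\<in>M. \<chi> x ^ Suc s) e \<noteq> 0" by (elim allE[of _ "Suc s"] impE) simp_all
  qed
  finally show ?case .
qed

end


section \<open>Averaging over the monoid\<close>

text \<open>A list of pairs stands for an element of the tensor product of the coordinate ring with a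
  polynomial ring, that is, for a polynomial whose coefficients are functions on the monoid.\<close>

type_synonym ('n, 'k, 'v) tensor = "((('n \<Rightarrow> 'k) \<Rightarrow> 'k) \<times> ('v, 'k) mpoly) list"

context omega_monoid
begin

definition tensor :: "('n, 'k, 'v) tensor \<Rightarrow> bool"
  where "tensor L \<longleftrightarrow> (\<forall>(f, q)\<in>set L. f \<in> coord_ring M)"

definition tensor_eval :: "('n, 'k, 'v) tensor \<Rightarrow> ('n \<Rightarrow> 'k) \<Rightarrow> ('v, 'k) mpoly"
  where "tensor_eval L x = (\<Sum>(f, q)\<leftarrow>L. Const (f x) * q)"

definition average :: "nat \<Rightarrow> ('n, 'k, 'v) tensor \<Rightarrow> ('v, 'k) mpoly"
  where "average s L = (\<Sum>(f, q)\<leftarrow>L. Const (eps s f) * q)"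

lemma lookup_average:
  assumes "tensor L"
  shows "(\<lambda>x\<in>M. Poly_Mapping.lookup (tensor_eval L x) m) \<in> coord_ring M"
    and "Poly_Mapping.lookup (average s L) m = eps s (\<lambda>x\<in>M. Poly_Mapping.lookup (tensor_eval L x) m)"
  using assms
proof (induction L)
  case Nil
  have eq: "(\<lambda>x\<in>M. Poly_Mapping.lookup (tensor_eval [] x) m) = (\<lambda>x\<in>M. 0 * \<chi> x)"
    by (rule restrict_ext) (simp add: tensor_eval_def)
  { case 1 show ?case unfolding eq by (rule coord_ring_closed(3)[OF char(1) char(1)]) }
  { case 2 show ?case unfolding eq eps_linear(2)[OF char(1)] by (simp add: average_def) }
next
  case (Cons a L)
  obtain f q where a: "a = (f, q)" by fastforce
  let ?l = "Poly_Mapping.lookup q m"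
  have eq: "(\<lambda>x\<in>M. Poly_Mapping.lookup (tensor_eval (a # L) x) m) =
    (\<lambda>x\<in>M. (\<lambda>x\<in>M. ?l * f x) x + (\<lambda>x\<in>M. Poly_Mapping.lookup (tensor_eval L x) m) x)"
    by (auto simp: a tensor_eval_def lookup_add lookup_Const_mult)
  { case 1
    then have f: "f \<in> coord_ring M" and L: "tensor L" by (auto simp: tensor_def a)
    show ?case unfolding eq
      by (rule coord_ring_closed(1)[OF coord_ring_closed(3)[OF f f] Cons.IH(1)[OF L]]) }
  { case 2
    then have f: "f \<in> coord_ring M" and L: "tensor L" by (auto simp: tensor_def a)
    have "Poly_Mapping.lookup (average s (a # L)) m = ?l * eps s f + Poly_Mapping.lookup (average s L) m"
      by (simp add: a average_def lookup_add lookup_Const_mult)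
    then show ?case unfolding eq
      eps_linear(1)[OF coord_ring_closed(3)[OF f f] Cons.IH(1)[OF L]] eps_linear(2)[OF f] Cons.IH(2)[OF L] . }
qed

text \<open>A coefficient of the average is the functional \<open>eps s\<close> applied to a coefficient function, and such a
  function is determined by its values on the dense unit group.\<close>

lemma average_cong:
  assumes L: "tensor L" "tensor L'" and eq: "\<And>g. g \<in> G \<Longrightarrow> tensor_eval L g = tensor_eval L' g"
  shows "average s L = average s L'"
proof (rule poly_mapping_eqI)
  fix m
  have "Poly_Mapping.lookup (tensor_eval L x) m = Poly_Mapping.lookup (tensor_eval L' x) m" if x: "x \<in> M" for x
    using eq_on_units[OF lookup_average(1)[OF L(1), of m] lookup_average(1)[OF L(2), of m] _ x] eq x
    by (simp add: units)
  then show "Poly_Mapping.lookup (average s L) m = Poly_Mapping.lookup (average s L') m"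
    unfolding lookup_average(2)[OF L(1)] lookup_average(2)[OF L(2)]
    by (intro arg_cong[of _ _ "eps s"] restrict_ext)
qed

lemma tensor_append:
  "tensor (L @ L') \<longleftrightarrow> tensor L \<and> tensor L'"
  "tensor_eval (L @ L') x = tensor_eval L x + tensor_eval L' x"
  "average s (L @ L') = average s L + average s L'"
  by (auto simp: tensor_def tensor_eval_def average_def)

lemma tensor_map_poly:
  fixes L :: "('n, 'k, 'v) tensor" and T :: "('v, 'k) mpoly \<Rightarrow> ('v, 'k) mpoly"
  assumes "T 0 = 0" "\<And>p q. T (p + q) = T p + T q" "\<And>c p. T (Const c * p) = Const c * T p"
  shows "tensor (map (apsnd T) L) = tensor L"
    "tensor_eval (map (apsnd T) L) x = T (tensor_eval L x)"
    "average s (map (apsnd T) L) = T (average s L)"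
proof -
  show "tensor (map (apsnd T) L) = tensor L" by (auto simp: tensor_def)
  show "tensor_eval (map (apsnd T) L) x = T (tensor_eval L x)"
    by (induction L) (auto simp: tensor_eval_def assms)
  show "average s (map (apsnd T) L) = T (average s L)"
    by (induction L) (auto simp: average_def assms)
qed

lemma tensor_rtrans:
  assumes L: "tensor L" and h: "h \<in> M"
  shows "tensor (map (apfst (\<lambda>f. rtrans f h)) L)"
    "x \<in> M \<Longrightarrow> tensor_eval (map (apfst (\<lambda>f. rtrans f h)) L) x = tensor_eval L (mul h x)"
    "average s (map (apfst (\<lambda>f. rtrans f h)) L) = Const (\<chi> h ^ s) * average s L"
proof -
  show "tensor (map (apfst (\<lambda>f. rtrans f h)) L)"
    using L rtrans_coord[OF _ h] unfolding tensor_def by fastforce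
  show "tensor_eval (map (apfst (\<lambda>f. rtrans f h)) L) x = tensor_eval L (mul h x)" if "x \<in> M"
    using that by (induction L) (auto simp: tensor_eval_def rtrans_def)
  show "average s (map (apfst (\<lambda>f. rtrans f h)) L) = Const (\<chi> h ^ s) * average s L"
    using L
  proof (induction L)
    case (Cons a L)
    obtain f q where a: "a = (f, q)" by fastforce
    have f: "f \<in> coord_ring M" and L: "tensor L" using Cons.prems by (auto simp: tensor_def a)
    show ?case using Cons.IH[OF L]
      by (simp add: average_def a eps_rtrans[OF f h] distrib_left Const_simps mult.assoc)
  qed (simp add: average_def)
qed

lemma tensor_mult:
  assumes "tensor L" "tensor L'"
  shows "\<exists>L''. tensor L'' \<and> (\<forall>x\<in>M. tensor_eval L'' x = tensor_eval L x * tensor_eval L' x)"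
  using assms(1)
proof (induction L)
  case Nil
  show ?case by (intro exI[of _ "[]"]) (simp add: tensor_def tensor_eval_def)
next
  case (Cons a L)
  obtain f q where a: "a = (f, q)" by fastforce
  have f: "f \<in> coord_ring M" and "tensor L" using Cons.prems by (auto simp: tensor_def a)
  then obtain K where K: "tensor K" "\<forall>x\<in>M. tensor_eval K x = tensor_eval L x * tensor_eval L' x"
    using Cons.IH by blast
  let ?F = "map (\<lambda>(f', q'). (\<lambda>x\<in>M. f x * f' x, q * q')) L'"
  have F: "tensor ?F" using assms(2) f by (auto simp: tensor_def intro!: coord_ring_closed(2))
  have "tensor_eval ?F x = Const (f x) * q * tensor_eval L' x" if "x \<in> M" for x
    using that by (induction L') (auto simp: tensor_eval_def Const_simps algebra_simps)
  then show ?case using F K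
    by (intro exI[of _ "?F @ K"]) (simp add: tensor_append, simp add: tensor_eval_def a distrib_right)
qed

text \<open>The coefficients of \<open>F\<close> are fractions of functions on the monoid with the common denominator
  \<open>\<chi> ^ s\<close>; the tensor \<open>L\<close> holds the numerators.\<close>

definition rational_with :: "nat \<Rightarrow> (('n \<Rightarrow> 'k) \<Rightarrow> ('v, 'k) mpoly) \<Rightarrow> ('n, 'k, 'v) tensor \<Rightarrow> bool"
  where "rational_with s F L \<longleftrightarrow> tensor L \<and> (\<forall>g\<in>G. tensor_eval L g = Const (\<chi> g ^ s) * F g)"

lemma rational_with_char:
  assumes "rational_with s F L" "s \<le> t"
  shows "\<exists>L. rational_with t F L"
proof -
  let ?K = "[(\<lambda>x\<in>M. \<chi> x ^ (t - s), 1)]"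
  have K: "tensor ?K" by (simp add: tensor_def char_power)
  obtain N where N: "tensor N" "\<forall>x\<in>M. tensor_eval N x = tensor_eval ?K x * tensor_eval L x"
    using tensor_mult[OF K] assms(1) unfolding rational_with_def by blast
  have "rational_with t F N"
    unfolding rational_with_def
  proof (intro conjI N ballI)
    fix g assume g: "g \<in> G"
    then have gM: "g \<in> M" by (simp add: units)
    have "\<chi> g ^ t = \<chi> g ^ (t - s) * \<chi> g ^ s" using assms(2) by (simp flip: power_add)
    then show "tensor_eval N g = Const (\<chi> g ^ t) * F g"
      using assms(1) N(2) g gM by (simp add: rational_with_def tensor_eval_def Const_simps mult.assoc)
  qed
  then show ?thesis ..
qed

lemma rational_with_closed:
  assumes "rational_with s F K" "rational_with t H L"
  shows "\<exists>r N. rational_with r (\<lambda>g. F g + H g) N" "\<exists>r N. rational_with r (\<lambda>g. F g * H g) N"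
proof -
  obtain K' L' where KL: "rational_with (s + t) F K'" "rational_with (s + t) H L'"
    using rational_with_char[OF assms(1), of "s + t"] rational_with_char[OF assms(2), of "s + t"] by auto
  then have "rational_with (s + t) (\<lambda>g. F g + H g) (K' @ L')"
    by (simp add: rational_with_def tensor_append distrib_left)
  then show "\<exists>r N. rational_with r (\<lambda>g. F g + H g) N" by blast
  obtain N where "tensor N" "\<forall>x\<in>M. tensor_eval N x = tensor_eval K x * tensor_eval L x"
    using tensor_mult assms unfolding rational_with_def by blast
  then have "rational_with (s + t) (\<lambda>g. F g * H g) N"
    using assms by (simp add: rational_with_def units Const_simps power_add mult_ac)
  then show "\<exists>r N. rational_with r (\<lambda>g. F g * H g) N" by blast
qed

lemma rational_with_const: "\<exists>s L. rational_with s (\<lambda>g. p) L"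
proof -
  have "rational_with 0 (\<lambda>g. p) [(\<lambda>x\<in>M. \<chi> x ^ 0, p)]"
    using char_power[of 0] by (auto simp: rational_with_def tensor_def tensor_eval_def units Const_simps)
  then show ?thesis by blast
qed

lemma rational_with_sum:
  "(\<And>i. i \<in> I \<Longrightarrow> \<exists>s L. rational_with s (F i) L) \<Longrightarrow> \<exists>s L. rational_with s (\<lambda>g. \<Sum>i\<in>I. F i g) L"
proof (induction I rule: infinite_finite_induct)
  case (insert i I)
  then obtain s K t L where "rational_with s (F i) K" "rational_with t (\<lambda>g. \<Sum>i\<in>I. F i g) L" by blast
  from rational_with_closed(1)[OF this] insert show ?case by simp
qed (use rational_with_const[of 0] in simp_all)

lemma rational_with_regular:
  assumes "(\<lambda>g\<in>G. c g) \<in> regular_functions G"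
  shows "\<exists>s L. rational_with s (\<lambda>g. Const (c g)) L"
proof -
  have closed: "zariski_closed M" using irreducible by (simp add: irreducible_closed_def)
  obtain s f where f: "f \<in> coord_ring M" "\<And>x. x \<in> M \<Longrightarrow> \<chi> x \<noteq> 0 \<Longrightarrow> f x = \<chi> x ^ s * c x"
    using regular_on_principal_open[OF closed char(1), of "\<lambda>g\<in>G. c g"] assms by (auto simp: units)
  have "rational_with s (\<lambda>g. Const (c g)) [(f, 1)]"
    using f by (auto simp: rational_with_def tensor_def tensor_eval_def units Const_simps)
  then show ?thesis by blast
qed

text \<open>Averaging \<open>\<chi> g ^ s * act g p\<close> over \<open>g\<close> produces an invariant polynomial, since the factor
  \<open>\<chi> h ^ s\<close> by which \<open>eps s\<close> changes under translation by \<open>h\<close> compensates the one coming from the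
  character. Averaging is linear over the invariants and multiplies an invariant by a nonzero
  constant. Applied to a relation that expresses an invariant through invariants, it replaces the
  coefficients by invariants. The exponent \<open>s\<close> has to be chosen large enough for all coefficients
  at once.\<close>

lemma invariant_coefficients:
  fixes act :: "('n \<Rightarrow> 'k) \<Rightarrow> ('v, 'k) mpoly \<Rightarrow> ('v, 'k) mpoly"
  assumes act_hom: "\<And>g p q. act g (p + q) = act g p + act g q" "\<And>g p q. act g (p * q) = act g p * act g q"
      "\<And>g c. act g (Const c) = Const c"
    and act_act: "\<And>g h p. g \<in> G \<Longrightarrow> h \<in> G \<Longrightarrow> act g (act h p) = act (mul g h) p"
    and rational: "\<And>p. \<exists>s L. rational_with s (\<lambda>g. act g p) L"
    and I: "finite I" and inv: "\<And>g. g \<in> G \<Longrightarrow> act g f = f" "\<And>g i. g \<in> G \<Longrightarrow> i \<in> I \<Longrightarrow> act g (\<xi> i) = \<xi> i"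
    and f: "f = (\<Sum>i\<in>I. a i * \<xi> i)"
  shows "\<exists>b. (\<forall>i\<in>I. \<forall>g\<in>G. act g (b i) = b i) \<and> f = (\<Sum>i\<in>I. b i * \<xi> i)"
proof -
  have act_0: "act g 0 = 0" for g using act_hom(3)[of g 0] by (simp add: Const_simps)
  have act_sum: "act g (sum h J) = (\<Sum>j\<in>J. act g (h j))" for g h and J :: "'i set"
    by (induction J rule: infinite_finite_induct) (auto simp: act_0 act_hom)
  have "\<forall>i. \<exists>s. \<exists>L. rational_with s (\<lambda>g. act g (a i)) L" using rational by (intro allI)
  from choice[OF this] obtain t where t: "\<forall>i. \<exists>L. rational_with (t i) (\<lambda>g. act g (a i)) L" ..
  from choice[OF this] obtain K where K: "\<forall>i. rational_with (t i) (\<lambda>g. act g (a i)) (K i)" ..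
  define s where "s = (\<Sum>i\<in>I. t i)"
  have "\<forall>i\<in>I. \<exists>L. rational_with s (\<lambda>g. act g (a i)) L"
    unfolding s_def by (intro ballI rational_with_char[OF K[THEN spec]] member_le_sum I) simp_all
  from bchoice[OF this] obtain L where "\<forall>i\<in>I. rational_with s (\<lambda>g. act g (a i)) (L i)" ..
  then have L: "rational_with s (\<lambda>g. act g (a i)) (L i)" if "i \<in> I" for i using that by (rule bspec)
  define c where "c = eps s (\<lambda>x\<in>M. \<chi> x ^ s)"
  have c: "c \<noteq> 0" unfolding c_def by (rule eps_char_power)
  have invL: "act h (average s N) = average s N" if N: "rational_with s (\<lambda>g. act g p) N" and h: "h \<in> G" for N p h
  proof -
    have hM: "h \<in> M" and nz: "\<chi> h \<noteq> 0" and tN: "tensor N"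
      using N h by (auto simp: units rational_with_def)
    \<comment> \<open>The scalar in \<open>?T\<close> turns the action of \<open>h\<close> on values into a translation of the argument.\<close>
    let ?T = "\<lambda>p. Const (\<chi> h ^ s) * act h p"
    have T: "?T 0 = 0" "?T (p + q) = ?T p + ?T q" "?T (Const d * p) = Const d * ?T p" for p q d
      by (simp_all add: act_0 act_hom algebra_simps)
    have "average s (map (apsnd ?T) N) = average s (map (apfst (\<lambda>f. rtrans f h)) N)"
    proof (rule average_cong)
      show "tensor (map (apsnd ?T) N)" using tensor_map_poly(1)[of ?T, OF T] tN by blast
      show "tensor (map (apfst (\<lambda>f. rtrans f h)) N)" by (rule tensor_rtrans(1)[OF tN hM])
      fix g assume g: "g \<in> G"
      have "tensor_eval (map (apsnd ?T) N) g = Const (\<chi> h ^ s) * act h (Const (\<chi> g ^ s) * act g p)"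
        using tensor_map_poly(2)[of ?T, OF T] N g by (simp add: rational_with_def)
      also have "\<dots> = Const (\<chi> (mul h g) ^ s) * act (mul h g) p"
        using g hM act_act[OF h g] by (simp add: act_hom units char power_mult_distrib Const_simps mult.assoc)
      also have "\<dots> = tensor_eval N (mul h g)" using N mul_units[OF h g] by (simp add: rational_with_def)
      also have "\<dots> = tensor_eval (map (apfst (\<lambda>f. rtrans f h)) N) g"
        using tensor_rtrans(2)[OF tN hM, of g] g by (simp add: units)
      finally show "tensor_eval (map (apsnd ?T) N) g = tensor_eval (map (apfst (\<lambda>f. rtrans f h)) N) g" .
    qed
    then have "Const (\<chi> h ^ s) * act h (average s N) = Const (\<chi> h ^ s) * average s N"
      unfolding tensor_map_poly(3)[of ?T, OF T] tensor_rtrans(3)[OF tN hM] .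
    then show ?thesis using Const_inverse_mult[of "\<chi> h ^ s"] nz by (metis power_not_zero)
  qed
  obtain idx where "set idx = I" "distinct idx" using finite_distinct_list[OF I] by blast
  let ?L = "concat (map (\<lambda>i. map (apsnd (\<lambda>p. p * \<xi> i)) (L i)) idx)"
  have T: "(0 :: ('v, 'k) mpoly) * \<xi> i = 0" "(p + q) * \<xi> i = p * \<xi> i + q * \<xi> i"
    "(Const d * p) * \<xi> i = Const d * (p * \<xi> i)" for i p q d by (simp_all add: algebra_simps)
  note TT = tensor_map_poly[of "\<lambda>p. p * \<xi> _", OF T]
  have sub: "tensor (concat (map (\<lambda>i. map (apsnd (\<lambda>p. p * \<xi> i)) (L i)) js)) \<and>
     tensor_eval (concat (map (\<lambda>i. map (apsnd (\<lambda>p. p * \<xi> i)) (L i)) js)) x = (\<Sum>i\<in>set js. tensor_eval (L i) x * \<xi> i) \<and>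
     average s (concat (map (\<lambda>i. map (apsnd (\<lambda>p. p * \<xi> i)) (L i)) js)) = (\<Sum>i\<in>set js. average s (L i) * \<xi> i)"
    if "set js \<subseteq> I" "distinct js" for js x
    using that
  proof (induction js)
    case Nil
    then show ?case by (simp add: tensor_def tensor_eval_def average_def)
  next
    case (Cons i js)
    then show ?case using L[of i] by (simp add: tensor_append TT rational_with_def)
  qed
  have "average s [(\<lambda>x\<in>M. \<chi> x ^ s, f)] = average s ?L"
  proof (rule average_cong)
    show "tensor [(\<lambda>x\<in>M. \<chi> x ^ s, f)]" by (simp add: tensor_def char_power)
    show "tensor ?L" using sub \<open>set idx = I\<close> \<open>distinct idx\<close> by blast
    fix g assume g: "g \<in> G"
    have "tensor_eval ?L g = (\<Sum>i\<in>I. tensor_eval (L i) g * \<xi> i)"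
      using sub[of idx g] \<open>set idx = I\<close> \<open>distinct idx\<close> by simp
    also have "\<dots> = (\<Sum>i\<in>I. Const (\<chi> g ^ s) * act g (a i * \<xi> i))"
      using L g inv(2) by (intro sum.cong) (auto simp: rational_with_def act_hom mult.assoc)
    also have "\<dots> = Const (\<chi> g ^ s) * act g f"
      by (simp add: f act_sum sum_distrib_left)
    finally show "tensor_eval [(\<lambda>x\<in>M. \<chi> x ^ s, f)] g = tensor_eval ?L g"
      using g inv(1) by (simp add: tensor_eval_def units)
  qed
  then have "Const c * f = (\<Sum>i\<in>I. average s (L i) * \<xi> i)"
    using sub[of idx] \<open>set idx = I\<close> \<open>distinct idx\<close> by (simp add: average_def c_def)
  then have "Const (inverse c) * (Const c * f) = (\<Sum>i\<in>I. (Const (inverse c) * average s (L i)) * \<xi> i)"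
    by (simp add: sum_distrib_left mult.assoc)
  then have eq: "f = (\<Sum>i\<in>I. (Const (inverse c) * average s (L i)) * \<xi> i)"
    by (simp add: Const_inverse_mult[OF c])
  have "act g (Const (inverse c) * average s (L i)) = Const (inverse c) * average s (L i)"
    if "g \<in> G" "i \<in> I" for g i
    using invL[OF L[OF that(2)] that(1)] by (simp add: act_hom)
  then show ?thesis
    by (intro exI[of _ "\<lambda>i. Const (inverse c) * average s (L i)"] conjI ballI eq)
qed

end


section \<open>The grading of a polynomial ring\<close>

text \<open>Substituting \<open>v t\<close> for each variable \<open>v\<close>, with a new variable \<open>t\<close>, collects the homogeneous
  components as the coefficients of the powers of \<open>t\<close>.\<close>

definition grading :: "('x, 'k::comm_ring_1) mpoly \<Rightarrow> ('x, 'k) mpoly poly"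
  where "grading = mp_eval (\<lambda>c. [:Const c:]) (\<lambda>v. monom (Var v) 1)"

abbreviation component :: "nat \<Rightarrow> ('x, 'k::comm_ring_1) mpoly \<Rightarrow> ('x, 'k) mpoly"
  where "component d p \<equiv> coeff (grading p) d"

lemma grading_simps [simp]:
  "grading (p + q) = grading p + grading q" "grading (p * q) = grading p * grading q"
  "grading (Const c) = [:Const c:]" "grading (Var v) = monom (Var v) 1"
  "grading (sum f I) = (\<Sum>i\<in>I. grading (f i))" "grading 0 = 0"
  unfolding grading_def
  by (rule mp_eval_add mp_eval_mult mp_eval_Const mp_eval_Var mp_eval_sum mp_eval_0;
    simp add: Const_simps one_pCons mult.commute)+

lemma sum_components: "p = (\<Sum>d\<le>degree (grading p). component d p)"
proof -
  have "poly (grading p) 1 = p"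
    by (induction p rule: mpoly_induct) (simp_all add: poly_monom)
  then show ?thesis by (simp add: poly_altdef)
qed

lemma component_0: "component 0 p = Const (peval p (\<lambda>_. 0))"
  by (induction p rule: mpoly_induct) (simp_all add: coeff_mult coeff_monom Const_simps)

lemma grading_component: "grading (component d p) = monom (component d p) d"
proof (induction p arbitrary: d rule: mpoly_induct)
  case (Const c)
  show ?case by (cases d) (simp_all add: monom_0)
next
  case (Var v)
  show ?case by (simp add: coeff_monom)
next
  case (add p q)
  then show ?case by (simp add: add_monom)
next
  case (mult p q)
  have "grading (component d (p * q)) = (\<Sum>i\<le>d. monom (component i p * component (d - i) q) d)"
    by (simp add: coeff_mult mult mult_monom)
  also have "\<dots> = monom (component d (p * q)) d"
    by (induction "{..d}" rule: infinite_finite_induct)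
      (simp_all add: coeff_mult poly_eq_iff coeff_sum coeff_monom)
  finally show ?case .
qed

lemma component_mult_homogeneous:
  assumes "grading q = monom q e"
  shows "component d (p * q) = (if e \<le> d then component (d - e) p * q else 0)"
  using assms by (simp add: coeff_monom_mult mult.commute[of "grading p"] mult.commute[of q])

lemma component_subst_linear:
  assumes "\<And>v. grading (\<sigma> v) = monom (\<sigma> v) 1"
  shows "component d (subst \<sigma> p) = subst \<sigma> (component d p)"
proof (induction p arbitrary: d rule: mpoly_induct)
  case (Const c)
  show ?case by (cases d) simp_all
qed (simp_all add: assms coeff_monom coeff_mult)


section \<open>Coordinates on the symmetric algebra\<close>

lemma sym_ideal_cong:
  assumes "p - p' \<in> sym_ideal scale" "q - q' \<in> sym_ideal scale"
  shows "(p + q) - (p' + q') \<in> sym_ideal scale" "p * q - p' * q' \<in> sym_ideal scale"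
proof -
  have "(p + q) - (p' + q') = (p - p') + (q - q')" by simp
  then show "(p + q) - (p' + q') \<in> sym_ideal scale" using sym_ideal_closed(2)[OF assms] by (simp only:)
  have "p * q - p' * q' = q * (p - p') + p' * (q - q')" by (simp add: algebra_simps)
  then show "p * q - p' * q' \<in> sym_ideal scale"
    using sym_ideal_closed(2)[OF sym_ideal_closed(4)[OF assms(1), of q] sym_ideal_closed(4)[OF assms(2), of p']]
    by (simp only:)
qed

lemma sym_ideal_generators:
  fixes scale :: "'a::field \<Rightarrow> 'b::ab_group_add \<Rightarrow> 'b"
  shows "Var (v + w) - Var v - Var w \<in> sym_ideal scale" "Var (scale c v) - Const c * Var v \<in> sym_ideal scale"
proof -
  interpret R: cring "mpoly_ring :: ('b, 'a) mpoly ring" by (rule cring_mpoly_ring)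
  show "Var (v + w) - Var v - Var w \<in> sym_ideal scale"
    "Var (scale c v) - Const c * Var v \<in> sym_ideal scale"
    unfolding sym_ideal_def by (rule set_mp[OF R.genideal_self], simp add: mpoly_ring_def, blast)+
qed

context finite_dimensional_vector_space
begin

text \<open>The representative of \<open>v\<close> in the symmetric algebra that involves only basis vectors as variables.
  Substituting it for every variable singles out one polynomial in each coset.\<close>

definition linform :: "'b \<Rightarrow> ('b, 'a) mpoly"
  where "linform v = (\<Sum>b\<in>Basis. Const (representation Basis v b) * Var b)"

lemma in_span: "v \<in> span Basis" by (simp add: span_Basis)

lemma linform_add: "linform (v + w) = linform v + linform w"
  by (simp add: linform_def representation_add[OF independent_Basis in_span in_span] Const_simps
    distrib_right sum.distrib)

lemma linform_scale: "linform (scale c v) = Const c * linform v"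
  by (simp add: linform_def representation_scale[OF independent_Basis in_span] Const_simps
    sum_distrib_left mult.assoc)

lemma linform_0: "linform 0 = 0"
  using linform_add[of 0 0] by simp

lemma linform_sum: "linform (sum f I) = (\<Sum>i\<in>I. linform (f i))"
  by (induction I rule: infinite_finite_induct) (simp_all add: linform_0 linform_add)

lemma basis_sum: "(\<Sum>b\<in>Basis. scale (representation Basis v b) b) = v"
  by (rule sum_representation_eq[OF independent_Basis in_span finite_Basis order.refl])

lemma grading_linform: "grading (linform v) = monom (linform v) 1"
proof -
  have "grading (linform v) = (\<Sum>b\<in>Basis. monom (Const (representation Basis v b) * Var b) 1)"
    by (simp add: linform_def smult_monom)
  then show ?thesis by (simp add: poly_eq_iff coeff_sum coeff_monom linform_def)
qed

abbreviation proj :: "('b, 'a) mpoly \<Rightarrow> ('b, 'a) mpoly"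
  where "proj \<equiv> subst linform"

lemma subst_linform:
  assumes T: "Vector_Spaces.linear scale scale T"
  shows "subst (\<lambda>v. linform (T v)) (linform v) = linform (T v)"
proof -
  interpret T: Vector_Spaces.linear scale scale T by (rule T)
  have "subst (\<lambda>v. linform (T v)) (linform v) =
    (\<Sum>b\<in>Basis. linform (T (scale (representation Basis v b) b)))"
    by (simp add: linform_def[of v] T.scale linform_scale)
  also have "\<dots> = linform (T (\<Sum>b\<in>Basis. scale (representation Basis v b) b))"
    by (simp add: linform_sum T.sum)
  finally show ?thesis by (simp add: basis_sum)
qed

lemma proj_linform: "proj (linform v) = linform v"
proof -
  have "Vector_Spaces.linear scale scale (\<lambda>v. v)"
    using linear_id by (simp add: id_def)
  from subst_linform[OF this] show ?thesis .
qed

lemma proj_proj: "proj (proj p) = proj p"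
  by (simp add: subst_subst proj_linform)

text \<open>The linear relations allow a vector to be expanded in the basis.\<close>

lemma proj_cong_sym_ideal: "p - proj p \<in> sym_ideal scale"
proof (induction p rule: mpoly_induct)
  case (Const c)
  show ?case by (simp add: sym_ideal_closed)
next
  case (Var v)
  have 0: "Var 0 \<in> sym_ideal scale"
    using sym_ideal_closed(3)[OF sym_ideal_generators(1)[of 0 0 scale]] by simp
  have "Var (\<Sum>b\<in>B. scale (c b) b) - (\<Sum>b\<in>B. Const (c b) * Var b) \<in> sym_ideal scale" for c B
  proof (induction B rule: infinite_finite_induct)
    case (insert b B)
    let ?s = "\<Sum>b\<in>B. scale (c b) b"
    let ?l = "\<Sum>b\<in>B. Const (c b) * Var b"
    have eq: "Var (scale (c b) b + ?s) - (Const (c b) * Var b + ?l) =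
      (Var (scale (c b) b + ?s) - Var (scale (c b) b) - Var ?s) +
      ((Var (scale (c b) b) - Const (c b) * Var b) + (Var ?s - ?l))" by simp
    show ?case
      unfolding sum.insert[OF insert.hyps] eq
      by (intro sym_ideal_closed(2) sym_ideal_generators insert.IH)
  qed (simp_all add: 0)
  from this[of "representation Basis v" Basis] show ?case by (simp add: basis_sum linform_def)
next
  case (add p q)
  then show ?case using sym_ideal_cong(1)[OF add] by simp
next
  case (mult p q)
  then show ?case using sym_ideal_cong(2)[OF mult] by simp
qed

text \<open>The substitution is linear in the vectors, so it respects the relations that generate the ideal.\<close>

lemma sym_ideal_proj: "p \<in> sym_ideal scale \<Longrightarrow> proj p = 0"
proof -
  let ?R = "mpoly_ring :: ('b, 'a) mpoly ring"
  interpret R: cring ?R by (rule cring_mpoly_ring)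
  have "ideal {p. proj p = 0} ?R"
  proof (rule idealI[OF R.ring_axioms])
    show "subgroup {p. proj p = 0} (add_monoid ?R)"
    proof (rule R.add.subgroupI)
      show "{p. proj p = 0} \<noteq> {}" using subst_simps(5)[of linform] by blast
      show "\<ominus>\<^bsub>?R\<^esub> a \<in> {p. proj p = 0}" if "a \<in> {p. proj p = 0}" for a
        using that by (simp add: mpoly_minus)
    qed (auto simp: mpoly_ring_def)
  qed (auto simp: mpoly_ring_def)
  moreover have "{Var (v + w) - Var v - Var w | v w. True} \<union> {Var (scale c v) - Const c * Var v | c v. True}
    \<subseteq> {p. proj p = 0}" by (auto simp: linform_add linform_scale)
  ultimately have "sym_ideal scale \<subseteq> {p. proj p = 0}" unfolding sym_ideal_def by (rule R.genideal_minimal)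
  then show "p \<in> sym_ideal scale \<Longrightarrow> proj p = 0" by blast
qed

lemma sym_class_proj: "sym_class scale (proj p) = sym_class scale p"
  using sym_ideal_closed(3)[OF proj_cong_sym_ideal[of p]] by (simp add: sym_class_eq_iff)

lemma sym_class_eq_iff_proj: "sym_class scale p = sym_class scale q \<longleftrightarrow> proj p = proj q"
proof
  assume "sym_class scale p = sym_class scale q"
  then show "proj p = proj q" using sym_ideal_proj[of "p - q"] by (simp add: sym_class_eq_iff)
next
  assume "proj p = proj q"
  then show "sym_class scale p = sym_class scale q" using sym_class_proj by metis
qed

text \<open>The map induced on the symmetric algebra by a linear map, on representatives in basis variables.\<close>

abbreviation induced :: "('b \<Rightarrow> 'b) \<Rightarrow> ('b, 'a) mpoly \<Rightarrow> ('b, 'a) mpoly"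
  where "induced T \<equiv> subst (\<lambda>v. linform (T v))"

lemma sym_map_fixed_iff:
  assumes T: "Vector_Spaces.linear scale scale T"
  shows "sym_map scale T (sym_class scale p) = sym_class scale p \<longleftrightarrow> induced T p = proj p"
  by (simp add: sym_map_class[OF T] sym_class_eq_iff_proj subst_subst)

lemma induced_induced:
  assumes "Vector_Spaces.linear scale scale S"
  shows "induced S (induced T p) = induced (\<lambda>v. S (T v)) p"
  by (simp add: subst_subst subst_linform[OF assms])

text \<open>The ring of polynomials in the finitely many basis variables is obtained from the field of constants by
  adjoining these variables.\<close>

lemma noetherian_coordinates:
  "\<exists>A. subring_set A \<and> noetherian A \<and> (\<forall>p. proj p \<in> A)"
proof -
  obtain bs where bs: "set bs = Basis" using finite_list[OF finite_Basis] by blast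
  let ?A = "adjoin_list (range Const) (map Var bs) :: ('b, 'a) mpoly set"
  note A = subring_adjoin_list[OF subring_range_Const]
  have C: "Const c \<in> ?A" for c by (rule adjoin_list_base[OF subring_range_Const]) simp
  have V: "linform v \<in> ?A" for v
    unfolding linform_def using bs
    by (intro subring_set_sum A subring_setD(4)[OF A] C adjoin_list_elem[OF subring_range_Const]) simp
  have "proj p \<in> ?A" for p by (rule subst_in_subring[OF A C V])
  with A noetherian_adjoin_list[OF subring_range_Const noetherian_range_Const] show ?thesis by blast
qed

end


section \<open>Hilbert's finiteness argument\<close>

lemma ring_hom_sym_class: "ring_hom_ring mpoly_ring (sym_algebra scale) (sym_class scale)"
proof -
  have "sym_class scale = (+>\<^bsub>mpoly_ring\<^esub>) (sym_ideal scale)" by (rule ext) (simp add: sym_class_def)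
  then show ?thesis unfolding sym_algebra_def by (simp only: ideal.rcos_ring_hom_ring[OF ideal_sym_ideal])
qed

lemma carrier_sym_algebra: "carrier (sym_algebra scale) = range (sym_class scale)"
  unfolding sym_algebra_def FactRing_def sym_class_def
  by (auto simp: A_RCOSETS_def' mpoly_ring_def)

lemma sum_in_additive_set:
  "0 \<in> B \<Longrightarrow> (\<And>p q. p \<in> B \<Longrightarrow> q \<in> B \<Longrightarrow> p + q \<in> B) \<Longrightarrow> (\<And>i. i \<in> J \<Longrightarrow> h i \<in> B) \<Longrightarrow> sum h J \<in> B"
  for B :: "'r::comm_monoid_add set"
  by (induction J rule: infinite_finite_induct) auto

context finite_dimensional_vector_space
begin

text \<open>By the Hilbert basis theorem the ideal generated by the homogeneous elements of positive degree
  of \<open>R\<close> has a finite set \<open>F\<close> of such generators. An element of \<open>R\<close> of degree \<open>d > 0\<close> is a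
  combination of elements of \<open>F\<close>, with coefficients that can be chosen in \<open>R\<close> by hypothesis.
  Keeping only the components of degree \<open>d\<close>, the coefficients have degree less than \<open>d\<close>, and by
  induction they are polynomials in the elements of \<open>F\<close>.\<close>

lemma graded_subalgebra_generated:
  fixes R :: "('b, 'a) mpoly set"
  assumes proj: "\<And>p. p \<in> R \<Longrightarrow> proj p = p"
    and comp: "\<And>p d. p \<in> R \<Longrightarrow> component d p \<in> R"
    and coeffs: "\<And>I f a. finite I \<Longrightarrow> I \<subseteq> R \<Longrightarrow> f \<in> R \<Longrightarrow> f = (\<Sum>\<xi>\<in>I. a \<xi> * \<xi>) \<Longrightarrow>
      \<exists>b. (\<forall>\<xi>\<in>I. b \<xi> \<in> R) \<and> f = (\<Sum>\<xi>\<in>I. b \<xi> * \<xi>)"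
  shows "\<exists>F. finite F \<and> F \<subseteq> R \<and> (\<forall>B. range Const \<subseteq> B \<longrightarrow> F \<subseteq> B \<longrightarrow>
    (\<forall>p\<in>B. \<forall>q\<in>B. p + q \<in> B \<and> p * q \<in> B) \<longrightarrow> R \<subseteq> B)"
proof -
  obtain A where A: "subring_set A" "noetherian A" "\<And>p. proj p \<in> A"
    using noetherian_coordinates by blast
  define S where "S = {component d p | d p. p \<in> R \<and> d > 0}"
  have SR: "S \<subseteq> R" unfolding S_def using comp by blast
  have "S \<subseteq> A"
  proof
    fix p assume "p \<in> S"
    then have "proj p = p" using SR proj by blast
    then show "p \<in> A" using A(3)[of p] by simp
  qed
  then obtain F where F: "F \<subseteq> S" "finite F" "S \<subseteq> ideal_span A F"
    using A(2) unfolding noetherian_def by meson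
  have "\<forall>\<xi>\<in>F. \<exists>e>0. grading \<xi> = monom \<xi> e"
    using F(1) grading_component unfolding S_def by blast
  from bchoice[OF this] obtain e where e: "\<forall>\<xi>\<in>F. e \<xi> > 0 \<and> grading \<xi> = monom \<xi> (e \<xi>)" ..
  have FR: "F \<subseteq> R" using F(1) SR by blast
  have "R \<subseteq> B" if B: "range Const \<subseteq> B" "F \<subseteq> B" "\<forall>p\<in>B. \<forall>q\<in>B. p + q \<in> B \<and> p * q \<in> B" for B
  proof
    have 0: "0 \<in> B" using B(1) Const_simps(1) by (metis rangeI subsetD)
    have add: "p \<in> B \<Longrightarrow> q \<in> B \<Longrightarrow> p + q \<in> B" for p q using B(3) by blast
    have comp_B: "component d f \<in> B" if "f \<in> R" for d f
      using that
    proof (induction d arbitrary: f rule: less_induct)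
      case (less d)
      show ?case
      proof (cases "d = 0")
        case True
        then show ?thesis using B(1) by (auto simp: component_0)
      next
        case False
        have "component d f \<in> S" unfolding S_def using False less.prems by blast
        then have "component d f \<in> ideal_span A ((\<lambda>\<xi>. \<xi>) ` F)" using F(3) by auto
        from ideal_span_image_sum[OF A(1) F(2) this] obtain a where a: "component d f = (\<Sum>\<xi>\<in>F. a \<xi> * \<xi>)" by blast
        from coeffs[OF F(2) FR comp[OF less.prems] a] obtain b where
          b: "\<forall>\<xi>\<in>F. b \<xi> \<in> R" "component d f = (\<Sum>\<xi>\<in>F. b \<xi> * \<xi>)" by blast
        have "component d f = component d (component d f)" by (simp add: grading_component)
        also have "\<dots> = (\<Sum>\<xi>\<in>F. component d (b \<xi> * \<xi>))" unfolding b(2) by (simp only: grading_simps coeff_sum)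
        also have "\<dots> \<in> B"
        proof (rule sum_in_additive_set[OF 0 add])
          fix \<xi> assume \<xi>: "\<xi> \<in> F"
          have "component (d - e \<xi>) (b \<xi>) \<in> B" using less.IH[of "d - e \<xi>" "b \<xi>"] b(1) e \<xi> False by simp
          then have "component (d - e \<xi>) (b \<xi>) * \<xi> \<in> B" using B \<xi> by blast
          then show "component d (b \<xi> * \<xi>) \<in> B"
            using component_mult_homogeneous[where q = \<xi> and e = "e \<xi>" and d = d and p = "b \<xi>"] e \<xi> 0 by simp
        qed
        finally show ?thesis .
      qed
    qed
    fix f assume "f \<in> R"
    have "(\<Sum>d\<le>degree (grading f). component d f) \<in> B"
      by (rule sum_in_additive_set[OF 0 add comp_B[OF \<open>f \<in> R\<close>]])
    then show "f \<in> B" by (simp flip: sum_components)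
  qed
  then show ?thesis using F(2) FR by (intro exI[of _ F]) blast
qed

lemma linear_representation: "Vector_Spaces.linear scale (*) (\<lambda>v. representation Basis v b)"
proof -
  have "vector_space ((*) :: 'a \<Rightarrow> 'a \<Rightarrow> 'a)" by unfold_locales (simp_all add: algebra_simps)
  then show ?thesis
    unfolding Vector_Spaces.linear_iff
    by (simp add: vector_space_axioms representation_add[OF independent_Basis in_span in_span]
      representation_scale[OF independent_Basis in_span])
qed

text \<open>The representatives in basis variables of the invariant cosets.\<close>

definition invariant_polys :: "'g set \<Rightarrow> ('g \<Rightarrow> 'b \<Rightarrow> 'b) \<Rightarrow> ('b, 'a) mpoly set"
  where "invariant_polys G \<rho> = {p. proj p = p \<and> (\<forall>g\<in>G. induced (\<rho> g) p = p)}"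

lemma sym_invariants_eq:
  assumes lin: "\<And>g. g \<in> G \<Longrightarrow> Vector_Spaces.linear scale scale (\<rho> g)"
  shows "sym_invariants scale G \<rho> = sym_class scale ` invariant_polys G \<rho>"
proof (intro subset_antisym subsetI)
  fix A assume A: "A \<in> sym_invariants scale G \<rho>"
  then obtain p where "A = sym_class scale p" by (auto simp: sym_invariants_def carrier_sym_algebra)
  then have p: "A = sym_class scale (proj p)" by (simp add: sym_class_proj)
  have "induced (\<rho> g) (proj p) = proj p" if "g \<in> G" for g
    using A that sym_map_fixed_iff[OF lin[OF that], of "proj p"] p
    by (simp add: sym_invariants_def proj_proj)
  then show "A \<in> sym_class scale ` invariant_polys G \<rho>"
    using p by (auto simp: invariant_polys_def proj_proj)
next
  fix A assume "A \<in> sym_class scale ` invariant_polys G \<rho>"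
  then obtain p where A: "A = sym_class scale p" and p: "proj p = p" "\<forall>g\<in>G. induced (\<rho> g) p = p"
    by (auto simp: invariant_polys_def)
  then have "\<forall>g\<in>G. sym_map scale (\<rho> g) A = A" using sym_map_fixed_iff[OF lin, of _ p] by simp
  then show "A \<in> sym_invariants scale G \<rho>" by (simp add: sym_invariants_def carrier_sym_algebra A)
qed

lemma generate_ring_invariants:
  assumes lin: "\<And>g. g \<in> G \<Longrightarrow> Vector_Spaces.linear scale scale (\<rho> g)"
    and F: "F \<subseteq> invariant_polys G \<rho>"
    and gen: "\<And>B. range Const \<subseteq> B \<Longrightarrow> F \<subseteq> B \<Longrightarrow> (\<forall>p\<in>B. \<forall>q\<in>B. p + q \<in> B \<and> p * q \<in> B) \<Longrightarrow>
      invariant_polys G \<rho> \<subseteq> B"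
  shows "sym_invariants scale G \<rho> =
    generate_ring (sym_algebra scale) (sym_scalars scale \<union> sym_class scale ` F)"
    (is "_ = generate_ring ?S ?H")
proof -
  interpret h: ring_hom_ring mpoly_ring "sym_algebra scale" "sym_class scale" by (rule ring_hom_sym_class)
  have R: "carrier (mpoly_ring :: ('b, 'a) mpoly ring) = UNIV" "\<one>\<^bsub>mpoly_ring\<^esub> = (1 :: ('b, 'a) mpoly)"
    "p \<oplus>\<^bsub>mpoly_ring\<^esub> q = p + q" "p \<otimes>\<^bsub>mpoly_ring\<^esub> q = p * q" for p q :: "('b, 'a) mpoly"
    by (simp_all add: mpoly_ring_def)
  let ?B = "{p. sym_class scale p \<in> generate_ring ?S ?H}"
  have gen_inv: "invariant_polys G \<rho> \<subseteq> ?B"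
  proof (rule gen)
    show "range Const \<subseteq> ?B" by (auto simp: sym_scalars_def intro: generate_ring.incl)
    show "F \<subseteq> ?B" by (auto intro: generate_ring.incl)
    show "\<forall>p\<in>?B. \<forall>q\<in>?B. p + q \<in> ?B \<and> p * q \<in> ?B"
      using h.hom_add h.hom_mult by (auto simp: R intro: generate_ring.eng_add generate_ring.eng_mult)
  qed
  have inv_gen: "A \<in> sym_class scale ` invariant_polys G \<rho>" if "A \<in> generate_ring ?S ?H" for A
    using that
  proof induction
    case one
    have "1 \<in> invariant_polys G \<rho>" by (simp add: invariant_polys_def)
    then show ?case using h.hom_one by (metis R(2) imageI)
  next
    case (incl A)
    have "Const c \<in> invariant_polys G \<rho>" for c by (simp add: invariant_polys_def)
    then show ?case using incl F by (auto simp: sym_scalars_def)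
  next
    case (a_inv A)
    then obtain p where p: "p \<in> invariant_polys G \<rho>" "A = sym_class scale p" by blast
    then have "- p \<in> invariant_polys G \<rho>" by (simp add: invariant_polys_def)
    moreover have "\<ominus>\<^bsub>?S\<^esub> A = sym_class scale (- p)" using h.hom_a_inv[of p] p by (simp add: R mpoly_minus)
    ultimately show ?case by blast
  next
    case (eng_add A B)
    then obtain p q where pq: "p \<in> invariant_polys G \<rho>" "A = sym_class scale p"
      "q \<in> invariant_polys G \<rho>" "B = sym_class scale q" by blast
    then have "p + q \<in> invariant_polys G \<rho>" by (simp add: invariant_polys_def)
    moreover have "A \<oplus>\<^bsub>?S\<^esub> B = sym_class scale (p + q)" using h.hom_add[of p q] pq by (simp add: R)
    ultimately show ?case by blast
  next
    case (eng_mult A B)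
    then obtain p q where pq: "p \<in> invariant_polys G \<rho>" "A = sym_class scale p"
      "q \<in> invariant_polys G \<rho>" "B = sym_class scale q" by blast
    then have "p * q \<in> invariant_polys G \<rho>" by (simp add: invariant_polys_def)
    moreover have "A \<otimes>\<^bsub>?S\<^esub> B = sym_class scale (p * q)" using h.hom_mult[of p q] pq by (simp add: R)
    ultimately show ?case by blast
  qed
  have eq: "sym_invariants scale G \<rho> = sym_class scale ` invariant_polys G \<rho>"
    by (rule sym_invariants_eq[OF lin])
  show ?thesis
    unfolding eq
  proof (intro subset_antisym image_subsetI subsetI)
    show "sym_class scale p \<in> generate_ring ?S ?H" if "p \<in> invariant_polys G \<rho>" for p
      using subsetD[OF gen_inv that] by (rule CollectD)
  qed (rule inv_gen)
qed

end

theorem theorem12: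
  fixes M :: "('n::finite \<Rightarrow> 'k::{alg_closed_field, field_char_0}) set"
    and mul :: "('n \<Rightarrow> 'k) \<Rightarrow> ('n \<Rightarrow> 'k) \<Rightarrow> ('n \<Rightarrow> 'k)"
    and e :: "'n \<Rightarrow> 'k"
    and \<chi> :: "('n \<Rightarrow> 'k) \<Rightarrow> 'k"
    and scale :: "'k \<Rightarrow> 'v::ab_group_add \<Rightarrow> 'v"
    and Basis :: "'v set"
    and \<rho> :: "('n \<Rightarrow> 'k) \<Rightarrow> 'v \<Rightarrow> 'v"
  assumes "linear_algebraic_monoid M mul e"
    and "\<exists>z. linear_algebraic_monoid.zero_element M mul z"
    and "linear_algebraic_monoid.nontrivial_character M mul e \<chi>"
    and "unit_group M mul e = {m \<in> M. \<chi> m \<noteq> 0}"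
    and "\<exists>\<Omega>. linear_algebraic_monoid.proper_omega_process M mul e \<chi> \<Omega>"
    and "finite_dimensional_vector_space scale Basis"
    and "linear_algebraic_monoid.rational_module M mul e scale \<rho>"
  shows "finitely_generated_algebra (sym_algebra scale) (sym_scalars scale)
    (sym_invariants scale (unit_group M mul e) \<rho>)"
proof -
  interpret mon: linear_algebraic_monoid M mul e by (rule assms(1))
  interpret fd: finite_dimensional_vector_space scale Basis by (rule assms(6))
  obtain z where z: "mon.zero_element z" using assms(2) by blast
  obtain \<Omega> where \<Omega>: "mon.proper_omega_process \<chi> \<Omega>" using assms(5) by blast
  interpret om: omega_monoid M mul e \<chi> \<Omega> z
    by unfold_locales (use z \<Omega> assms(4) in simp_all)
  let ?G = "unit_group M mul e"
  let ?Inv = "fd.invariant_polys ?G \<rho>"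
  let ?act = "\<lambda>g. fd.induced (\<rho> g)"
  have lin: "Vector_Spaces.linear scale scale (\<rho> g)" if "g \<in> ?G" for g
    using assms(7) that unfolding mon.rational_module_def by blast
  have \<rho>_mul: "\<rho> (mul g h) v = \<rho> g (\<rho> h v)" if "g \<in> ?G" "h \<in> ?G" for g h v
    using assms(7) that unfolding mon.rational_module_def by blast
  have coeff_regular: "(\<lambda>g\<in>?G. fd.representation Basis (\<rho> g v) b) \<in> regular_functions ?G" for v b
    using assms(7) fd.linear_representation[of b] unfolding mon.rational_module_def by blast
  have act_act: "?act g (?act h p) = ?act (mul g h) p" if "g \<in> ?G" "h \<in> ?G" for g h p
    by (simp add: fd.induced_induced[OF lin[OF that(1)]] \<rho>_mul[OF that])
  have rational: "\<exists>s L. om.rational_with s (\<lambda>g. ?act g p) L" for p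
  proof (induction p rule: mpoly_induct)
    case (Const c)
    show ?case by (simp add: om.rational_with_const)
  next
    case (Var v)
    have "\<exists>s L. om.rational_with s (\<lambda>g. Const (fd.representation Basis (\<rho> g v) b) * Var b) L" for b
    proof -
      obtain s K where K: "om.rational_with s (\<lambda>g. Const (fd.representation Basis (\<rho> g v) b) :: ('v, 'k) mpoly) K"
        using om.rational_with_regular[OF coeff_regular[of v b]] by blast
      obtain t L where L: "om.rational_with t (\<lambda>g. Var b :: ('v, 'k) mpoly) L"
        using om.rational_with_const by blast
      show ?thesis using om.rational_with_closed(2)[OF K L] .
    qed
    then show ?case by (simp add: fd.linform_def om.rational_with_sum)
  next
    case (add p q)
    obtain s K where K: "om.rational_with s (\<lambda>g. ?act g p) K" using add(1) by blast
    obtain t L where L: "om.rational_with t (\<lambda>g. ?act g q) L" using add(2) by blast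
    show ?case using om.rational_with_closed(1)[OF K L] by simp
  next
    case (mult p q)
    obtain s K where K: "om.rational_with s (\<lambda>g. ?act g p) K" using mult(1) by blast
    obtain t L where L: "om.rational_with t (\<lambda>g. ?act g q) L" using mult(2) by blast
    show ?case using om.rational_with_closed(2)[OF K L] by simp
  qed
  have act_e: "?act e p = fd.proj p" for p
    using assms(7) unfolding mon.rational_module_def by simp
  have Inv: "p \<in> ?Inv \<longleftrightarrow> (\<forall>g\<in>?G. ?act g p = p)" for p
    using act_e[of p] om.e_unit by (auto simp: fd.invariant_polys_def)
  have "\<exists>F. finite F \<and> F \<subseteq> ?Inv \<and> (\<forall>B. range Const \<subseteq> B \<longrightarrow> F \<subseteq> B \<longrightarrow>
    (\<forall>p\<in>B. \<forall>q\<in>B. p + q \<in> B \<and> p * q \<in> B) \<longrightarrow> ?Inv \<subseteq> B)"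
  proof (rule fd.graded_subalgebra_generated)
    show "fd.proj p = p" if "p \<in> ?Inv" for p using that by (simp add: fd.invariant_polys_def)
    show "component d p \<in> ?Inv" if "p \<in> ?Inv" for p d
      unfolding Inv
    proof
      fix g assume "g \<in> ?G"
      have "?act g (component d p) = component d (?act g p)"
        by (rule component_subst_linear[symmetric]) (rule fd.grading_linform)
      then show "?act g (component d p) = component d p" using that \<open>g \<in> ?G\<close> by (simp add: Inv)
    qed
  next
    fix I f and a :: "('v, 'k) mpoly \<Rightarrow> ('v, 'k) mpoly"
    assume I: "finite I" "I \<subseteq> ?Inv" "f \<in> ?Inv" "f = (\<Sum>\<xi>\<in>I. a \<xi> * \<xi>)"
    have "\<exists>b. (\<forall>\<xi>\<in>I. \<forall>g\<in>?G. ?act g (b \<xi>) = b \<xi>) \<and> f = (\<Sum>\<xi>\<in>I. b \<xi> * \<xi>)"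
    proof (rule om.invariant_coefficients[where act = ?act])
      show "?act g f = f" if "g \<in> ?G" for g using I(3) that by (simp add: Inv)
      show "?act g \<xi> = \<xi>" if "g \<in> ?G" "\<xi> \<in> I" for g \<xi> using I(2) that by (auto simp: Inv)
    qed (use I act_act rational in auto)
    then show "\<exists>b. (\<forall>\<xi>\<in>I. b \<xi> \<in> ?Inv) \<and> f = (\<Sum>\<xi>\<in>I. b \<xi> * \<xi>)" by (simp add: Inv)
  qed
  then obtain F where F: "finite F" "F \<subseteq> ?Inv" and gen: "\<forall>B. range Const \<subseteq> B \<longrightarrow> F \<subseteq> B \<longrightarrow>
      (\<forall>p\<in>B. \<forall>q\<in>B. p + q \<in> B \<and> p * q \<in> B) \<longrightarrow> ?Inv \<subseteq> B"
    by (elim exE conjE)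
  have eq: "sym_invariants scale ?G \<rho> = sym_class scale ` ?Inv"
    by (rule fd.sym_invariants_eq[OF lin])
  have "sym_invariants scale ?G \<rho> = generate_ring (sym_algebra scale) (sym_scalars scale \<union> sym_class scale ` F)"
    by (rule fd.generate_ring_invariants[OF lin F(2) gen[rule_format]]) blast+
  moreover have "sym_class scale ` F \<subseteq> sym_invariants scale ?G \<rho>"
    unfolding eq by (rule image_mono[OF F(2)])
  ultimately show ?thesis
    unfolding finitely_generated_algebra_def using F(1) by blast
qed

end
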